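(* Let $\mathcal{A}$ be a C$^*$-algebra (unital, or not), let $G$ be a finite-dimensional Lie group with Lie algebra $\mathfrak{g}$, and let $\alpha\colon g\mapsto\alpha_g$ be a strongly continuous representation of $G$ implemented by $*$-automorphisms on $\mathcal{A}$. Then the $*$-algebra $$C^\infty(\alpha):=\{a\in\mathcal{A}: G\ni g\mapsto\alpha_g(a)\text{ is of class }C^\infty\}$$ of smooth elements for the representation $\alpha$ admits only one C$^*$-norm, which is the restriction of $\|\cdot\|_{\mathcal{A}}$ to $C^\infty(\alpha)$.
   Context: $\|\cdot\|_{\mathcal{A}}$ is the C$^*$-norm of $\mathcal{A}$. Strong continuity means that $g\mapsto\alpha_g(a)$ is norm-continuous for each $a\in\mathcal{A}$; smoothness of $g\mapsto\alpha_g(a)$ is with respect to the norm topology of $\mathcal{A}$. A C$^*$-norm on a $*$-algebra (not assumed complete) is a submultiplicative vector space norm $p$ with $p(b^* )=p(b)$ and $p(b^*b)=p(b)^2$ for all $b$. *)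

theory Defs
  imports "HOL-Analysis.Analysis" "HOL-Algebra.Group"
begin

section \<open>C*-algebras\<close>

text \<open>The class \<^class>\<open>real_normed_algebra\<close> does not assume a unit (and its norm is
  submultiplicative), so the algebras below are unital or not; the zero algebra is allowed.\<close>

class cstar_algebra = real_normed_algebra + banach +
  fixes scaleC :: "complex \<Rightarrow> 'a \<Rightarrow> 'a" (infixr "*\<^sub>C" 75)
    and star :: "'a \<Rightarrow> 'a" ("_\<^sup>\<star>" [1000] 999)
  assumes scaleR_scaleC: "r *\<^sub>R x = complex_of_real r *\<^sub>C x"
    and scaleC_add_right: "z *\<^sub>C (x + y) = z *\<^sub>C x + z *\<^sub>C y"
    and scaleC_add_left: "(z + w) *\<^sub>C x = z *\<^sub>C x + w *\<^sub>C x"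
    and scaleC_scaleC: "z *\<^sub>C (w *\<^sub>C x) = (z * w) *\<^sub>C x"
    and mult_scaleC_left: "(z *\<^sub>C x) * y = z *\<^sub>C (x * y)"
    and mult_scaleC_right: "x * (z *\<^sub>C y) = z *\<^sub>C (x * y)"
    and norm_scaleC: "norm (z *\<^sub>C x) = cmod z * norm x"
    and star_add: "(x + y)\<^sup>\<star> = x\<^sup>\<star> + y\<^sup>\<star>"
    and star_scaleC: "(z *\<^sub>C x)\<^sup>\<star> = cnj z *\<^sub>C x\<^sup>\<star>"
    and star_mult: "(x * y)\<^sup>\<star> = y\<^sup>\<star> * x\<^sup>\<star>"
    and star_star: "(x\<^sup>\<star>)\<^sup>\<star> = x"
    and cstar_identity: "norm (x\<^sup>\<star> * x) = (norm x)\<^sup>2"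

definition star_automorphism :: "('a::cstar_algebra \<Rightarrow> 'a) \<Rightarrow> bool" where
  "star_automorphism f \<longleftrightarrow> bij f
     \<and> (\<forall>x y. f (x + y) = f x + f y)
     \<and> (\<forall>z x. f (z *\<^sub>C x) = z *\<^sub>C f x)
     \<and> (\<forall>x y. f (x * y) = f x * f y)
     \<and> (\<forall>x. f (x\<^sup>\<star>) = (f x)\<^sup>\<star>)"

definition star_subalgebra :: "'a::cstar_algebra set \<Rightarrow> bool" where
  "star_subalgebra B \<longleftrightarrow> 0 \<in> B
     \<and> (\<forall>x\<in>B. \<forall>y\<in>B. x + y \<in> B)
     \<and> (\<forall>z. \<forall>x\<in>B. z *\<^sub>C x \<in> B)
     \<and> (\<forall>x\<in>B. \<forall>y\<in>B. x * y \<in> B)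
     \<and> (\<forall>x\<in>B. x\<^sup>\<star> \<in> B)"

text \<open>C*-norms on a *-subalgebra \<open>B\<close>, not assumed complete; only the values of \<open>p\<close> on \<open>B\<close> matter.\<close>

definition cstar_norm_on :: "'a::cstar_algebra set \<Rightarrow> ('a \<Rightarrow> real) \<Rightarrow> bool" where
  "cstar_norm_on B p \<longleftrightarrow>
       (\<forall>x\<in>B. 0 \<le> p x)
     \<and> (\<forall>x\<in>B. p x = 0 \<longleftrightarrow> x = 0)
     \<and> (\<forall>x\<in>B. \<forall>y\<in>B. p (x + y) \<le> p x + p y)
     \<and> (\<forall>z. \<forall>x\<in>B. p (z *\<^sub>C x) = cmod z * p x)
     \<and> (\<forall>x\<in>B. \<forall>y\<in>B. p (x * y) \<le> p x * p y)
     \<and> (\<forall>x\<in>B. p (x\<^sup>\<star>) = p x)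
     \<and> (\<forall>x\<in>B. p (x\<^sup>\<star> * x) = (p x)\<^sup>2)"


section \<open>Smooth maps between normed spaces\<close>

text \<open>Used for open \<open>S\<close> in a finite-dimensional domain. There, continuity of the derivative in
  operator norm is the same as continuity of \<open>x \<mapsto> Df(x) v\<close> for every vector \<open>v\<close>; this lets the
  recursion stay within functions into a fixed space. The target may be any normed space, and
  differentiability is Frechet differentiability for its norm.\<close>

fun Ck_on :: "nat \<Rightarrow> 'e::real_normed_vector set \<Rightarrow> ('e \<Rightarrow> 'f::real_normed_vector) \<Rightarrow> bool" where
  "Ck_on 0 S f \<longleftrightarrow> continuous_on S f"
| "Ck_on (Suc k) S f \<longleftrightarrow> (\<forall>x\<in>S. f differentiable (at x))
     \<and> (\<forall>v. Ck_on k S (\<lambda>x. frechet_derivative f (at x) v))"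

definition smooth_on :: "'e::real_normed_vector set \<Rightarrow> ('e \<Rightarrow> 'f::real_normed_vector) \<Rightarrow> bool" where
  "smooth_on S f \<longleftrightarrow> (\<forall>k. Ck_on k S f)"


section \<open>Finite-dimensional Lie groups\<close>

text \<open>A chart \<open>(U, \<phi>)\<close> is given by its domain and its coordinate map, with inverse
  \<^term>\<open>inv_into U \<phi>\<close>. The model space is any finite-dimensional real normed space; unlike for the
  class \<^class>\<open>euclidean_space\<close>, its dimension may be 0, so that discrete groups are included.\<close>

definition chart_on :: "'g topology \<Rightarrow> 'g set \<Rightarrow> ('g \<Rightarrow> 'e::real_normed_vector) \<Rightarrow> bool" where
  "chart_on T U \<phi> \<longleftrightarrow> openin T U \<and> open (\<phi> ` U)
     \<and> homeomorphic_map (subtopology T U) (top_of_set (\<phi> ` U)) \<phi>"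

locale smooth_manifold =
  fixes T :: "'g topology" and \<A> :: "('g set \<times> ('g \<Rightarrow> 'e::real_normed_vector)) set"
  assumes finite_dim: "\<exists>B::'e set. finite B \<and> span B = UNIV"
    and Hausdorff: "Hausdorff_space T"
    and charts: "\<And>U \<phi>. (U, \<phi>) \<in> \<A> \<Longrightarrow> chart_on T U \<phi>"
    and covering: "(\<Union>(U, \<phi>)\<in>\<A>. U) = topspace T"
    and transition: "\<And>U \<phi> V \<psi>. (U, \<phi>) \<in> \<A> \<Longrightarrow> (V, \<psi>) \<in> \<A> \<Longrightarrow>
          smooth_on (\<phi> ` (U \<inter> V)) (\<psi> \<circ> inv_into U \<phi>)"

text \<open>Smoothness of multiplication and inversion is stated in local coordinates; continuity makes
  the coordinate domains open.\<close>

locale lie_group = group G + smooth_manifold T \<A>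
  for G :: "('g, 'm) monoid_scheme" (structure)
    and T :: "'g topology" and \<A> :: "('g set \<times> ('g \<Rightarrow> 'e::real_normed_vector)) set" +
  assumes topspace_carrier: "topspace T = carrier G"
    and continuous_mult: "continuous_map (prod_topology T T) T (\<lambda>(g, h). g \<otimes> h)"
    and continuous_inv: "continuous_map T T (\<lambda>g. inv g)"
    and smooth_mult: "\<And>U \<phi> V \<psi> W \<eta>. (U, \<phi>) \<in> \<A> \<Longrightarrow> (V, \<psi>) \<in> \<A> \<Longrightarrow> (W, \<eta>) \<in> \<A> \<Longrightarrow>
          smooth_on {(x, y) \<in> \<phi> ` U \<times> \<psi> ` V. inv_into U \<phi> x \<otimes> inv_into V \<psi> y \<in> W}
            (\<lambda>(x, y). \<eta> (inv_into U \<phi> x \<otimes> inv_into V \<psi> y))"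
    and smooth_inv: "\<And>U \<phi> W \<eta>. (U, \<phi>) \<in> \<A> \<Longrightarrow> (W, \<eta>) \<in> \<A> \<Longrightarrow>
          smooth_on {x \<in> \<phi> ` U. inv (inv_into U \<phi> x) \<in> W} (\<lambda>x. \<eta> (inv (inv_into U \<phi> x)))"

definition smooth_map ::
  "('g set \<times> ('g \<Rightarrow> 'e::real_normed_vector)) set \<Rightarrow> ('g \<Rightarrow> 'f::real_normed_vector) \<Rightarrow> bool" where
  "smooth_map \<A> f \<longleftrightarrow> (\<forall>(U, \<phi>)\<in>\<A>. smooth_on (\<phi> ` U) (f \<circ> inv_into U \<phi>))"


section \<open>Actions on C*-algebras and their smooth elements\<close>

definition strongly_continuous_star_rep ::
  "('g, 'm) monoid_scheme \<Rightarrow> 'g topology \<Rightarrow> ('g \<Rightarrow> 'a::cstar_algebra \<Rightarrow> 'a) \<Rightarrow> bool" where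
  "strongly_continuous_star_rep G T \<alpha> \<longleftrightarrow>
       (\<forall>g\<in>carrier G. star_automorphism (\<alpha> g))
     \<and> \<alpha> \<one>\<^bsub>G\<^esub> = id
     \<and> (\<forall>g\<in>carrier G. \<forall>h\<in>carrier G. \<alpha> (g \<otimes>\<^bsub>G\<^esub> h) = \<alpha> g \<circ> \<alpha> h)
     \<and> (\<forall>a. continuous_map T euclidean (\<lambda>g. \<alpha> g a))"

definition smooth_elements ::
  "('g set \<times> ('g \<Rightarrow> 'e::real_normed_vector)) set \<Rightarrow> ('g \<Rightarrow> 'a::cstar_algebra \<Rightarrow> 'a) \<Rightarrow> 'a set" where
  "smooth_elements \<A> \<alpha> = {a. smooth_map \<A> (\<lambda>g. \<alpha> g a)}"

end

theory Submission
  imports Defs "HOL-Library.Periodic_Fun"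
begin

text \<open>Let \<open>p\<close> be a C*-norm on the smooth elements \<open>B\<close>. For self-adjoint \<open>c\<close> the identity
  \<open>\<bar>1 \<plusminus> ic\<bar>\<^sup>2 = 1 + c\<^sup>2\<close> gives \<open>2 p (cy) \<le> p (y + c\<^sup>2y)\<close>; together with the closure of \<open>B\<close> under
  quasi-inverses this yields \<open>p \<le> norm\<close> without spectral theory. Smooth elements are closed under
  smooth functions of unitaries \<open>u\<close> as well, because the derivatives of \<open>u\<^sup>n\<close> grow polynomially in
  \<open>n\<close> while Fourier coefficients decay rapidly. If \<open>p h < norm h\<close> for \<open>h = 1 - Re u\<close>, a cutoff
  \<open>F\<close> that vanishes for \<open>x \<le> r\<^sub>1\<close> and is \<open>1\<close> for \<open>x \<ge> r\<^sub>2\<close>, where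
  \<open>p h < r\<^sub>1 < r\<^sub>2 < norm h\<close>, satisfies \<open>p (F(h) h) = 0\<close>, whereas \<open>F(h) h = 0\<close> would force
  \<open>norm h \<le> r\<^sub>2\<close>. Both facts follow from the growth rates of \<open>h\<^sup>n\<close> against cosine series with
  \<open>C\<^sup>2\<close> symbols. Finally \<open>u\<close> is taken to be the Cayley transform of \<open>sb\<close> with \<open>s \<rightarrow> 0\<close>, so
  that \<open>h\<close> is asymptotically \<open>2 (sb)\<^sup>2\<close>.\<close>

section \<open>Calculus of \<open>C\<^sup>k\<close> maps\<close>

text \<open>In general \<open>B\<close> is not complete and \<open>p\<close> need not extend to the
  ambient algebra, so uniqueness of the norm of a C*-algebra cannot be quoted for it: every
  auxiliary element has to stay in \<open>B\<close>. The upper bound must come before the lower one,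
  because the latter estimates \<open>p\<close> of elements of the functional calculus by their
  norms. Analytic functions cannot give the lower bound, since it takes an element that kills a part
  of the spectrum; hence the cutoffs. The estimate of \<open>f(h)\<close> by the supremum of
  \<open>f\<close> is replaced by one in terms of derivatives of \<open>f\<close> up to order 2. For
  \<open>n\<close>-th powers this loses a factor polynomial in \<open>n\<close>, which is harmless
  because only geometric rates are compared. As a unit may be missing, \<open>1 + w\<close> is never
  an element but the operator \<open>y + w y\<close>, inverses become quasi-inverses, and functions
  of a unitary are always applied to some \<open>y\<close>.\<close>

lemma Ck_on_cong:
  assumes "open S" "\<And>x. x \<in> S \<Longrightarrow> f x = g x" "Ck_on k S f"
  shows "Ck_on k S g"
  using assms(2,3)
proof (induction k arbitrary: f g)
  case 0
  then show ?case by (auto cong: continuous_on_cong)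
next
  case (Suc k)
  have d: "(g has_derivative frechet_derivative f (at x)) (at x)" if "x \<in> S" for x
  proof (rule has_derivative_transform_within_open[OF _ assms(1) that Suc.prems(1)])
    show "(f has_derivative frechet_derivative f (at x)) (at x)"
      using Suc.prems(2) that by (simp add: frechet_derivative_works[symmetric])
  qed
  have "Ck_on k S (\<lambda>x. frechet_derivative g (at x) v)" for v
  proof (rule Suc.IH)
    show "frechet_derivative f (at x) v = frechet_derivative g (at x) v" if "x \<in> S" for x
      using frechet_derivative_at[OF d[OF that]] by simp
  qed (use Suc.prems(2) in simp)
  then show ?case using d by (auto simp: differentiable_def)
qed

lemma Ck_on_SucI:
  assumes "open S" "\<And>x. x \<in> S \<Longrightarrow> (f has_derivative f' x) (at x)"
    and "\<And>v. Ck_on k S (\<lambda>x. f' x v)"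
  shows "Ck_on (Suc k) S f"
proof -
  have "Ck_on k S (\<lambda>x. frechet_derivative f (at x) v)" for v
    by (rule Ck_on_cong[OF assms(1) _ assms(3)[of v]]) (use frechet_derivative_at[OF assms(2)] in simp)
  then show ?thesis using assms(2) by (auto simp: differentiable_def)
qed

lemma Ck_on_SucD:
  assumes "Ck_on (Suc k) S f"
  shows "\<exists>f'. (\<forall>x\<in>S. (f has_derivative f' x) (at x)) \<and> (\<forall>v. Ck_on k S (\<lambda>x. f' x v))"
  using assms by (intro exI[of _ "\<lambda>x. frechet_derivative f (at x)"]) (auto simp: frechet_derivative_works)

lemma Ck_on_continuous: "Ck_on k S f \<Longrightarrow> continuous_on S f"
  by (cases k) (auto intro!: continuous_at_imp_continuous_on differentiable_imp_continuous_within)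

lemma Ck_on_lower: "Ck_on (Suc k) S f \<Longrightarrow> Ck_on k S f"
proof (induction k arbitrary: f)
  case 0
  then show ?case using Ck_on_continuous[OF 0] by simp
qed auto

lemma Ck_on_local:
  assumes "\<And>x. x \<in> S \<Longrightarrow> \<exists>N. open N \<and> x \<in> N \<and> Ck_on k N f"
  shows "Ck_on k S f"
  using assms
proof (induction k arbitrary: f)
  case 0
  then show ?case
    by (metis Ck_on.simps(1) at_within_open continuous_at_imp_continuous_on continuous_on_eq_continuous_within)
next
  case (Suc k)
  have "\<exists>N. open N \<and> x \<in> N \<and> Ck_on k N (\<lambda>x. frechet_derivative f (at x) v)" if "x \<in> S" for x v
    using Suc.prems[OF that] by auto
  then have "Ck_on k S (\<lambda>x. frechet_derivative f (at x) v)" for v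
    by (rule Suc.IH)
  then show ?case using Suc.prems by fastforce
qed

lemma Ck_on_add:
  assumes "open S" "Ck_on k S f" "Ck_on k S g"
  shows "Ck_on k S (\<lambda>x. f x + g x)"
  using assms(2,3)
proof (induction k arbitrary: f g)
  case (Suc k)
  obtain f' where f': "\<And>x. x \<in> S \<Longrightarrow> (f has_derivative f' x) (at x)" "\<And>v. Ck_on k S (\<lambda>x. f' x v)"
    using Ck_on_SucD[OF Suc.prems(1)] by blast
  obtain g' where g': "\<And>x. x \<in> S \<Longrightarrow> (g has_derivative g' x) (at x)" "\<And>v. Ck_on k S (\<lambda>x. g' x v)"
    using Ck_on_SucD[OF Suc.prems(2)] by blast
  show ?case
    by (rule Ck_on_SucI[OF assms(1) has_derivative_add[OF f'(1) g'(1)]])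
      (auto intro: Suc.IH f' g')
qed (auto intro: continuous_intros)

lemma Ck_on_linear:
  assumes "open S" "bounded_linear L" "Ck_on k S f"
  shows "Ck_on k S (\<lambda>x. L (f x))"
  using assms(3)
proof (induction k arbitrary: f)
  case 0
  then show ?case by (auto intro: bounded_linear.continuous_on[OF assms(2)])
next
  case (Suc k)
  obtain f' where f': "\<And>x. x \<in> S \<Longrightarrow> (f has_derivative f' x) (at x)" "\<And>v. Ck_on k S (\<lambda>x. f' x v)"
    using Ck_on_SucD[OF Suc.prems(1)] by blast
  show ?case
    by (rule Ck_on_SucI[OF assms(1) bounded_linear.has_derivative[OF assms(2) f'(1)]])
      (auto intro: Suc.IH f')
qed

lemma Ck_on_bilinear:
  assumes "open S" "bounded_bilinear P" "Ck_on k S f" "Ck_on k S g"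
  shows "Ck_on k S (\<lambda>x. P (f x) (g x))"
  using assms(3,4)
proof (induction k arbitrary: f g)
  case 0
  then show ?case by (auto intro: bounded_bilinear.continuous_on[OF assms(2)])
next
  case (Suc k)
  obtain f' where f': "\<And>x. x \<in> S \<Longrightarrow> (f has_derivative f' x) (at x)" "\<And>v. Ck_on k S (\<lambda>x. f' x v)"
    using Ck_on_SucD[OF Suc.prems(1)] by blast
  obtain g' where g': "\<And>x. x \<in> S \<Longrightarrow> (g has_derivative g' x) (at x)" "\<And>v. Ck_on k S (\<lambda>x. g' x v)"
    using Ck_on_SucD[OF Suc.prems(2)] by blast
  show ?case
    by (rule Ck_on_SucI[OF assms(1) bounded_bilinear.FDERIV[OF assms(2) f'(1) g'(1)]])
      (auto intro!: Ck_on_add assms(1) Suc.IH f' g' Ck_on_lower[OF Suc.prems(1)] Ck_on_lower[OF Suc.prems(2)])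
qed

lemmas Ck_on_mult = Ck_on_bilinear[OF _ bounded_bilinear_mult]

lemma Ck_on_const: "open S \<Longrightarrow> Ck_on k S (\<lambda>x. c)"
proof (induction k arbitrary: c)
  case 0
  show ?case by (simp only: Ck_on.simps continuous_on_const)
next
  case (Suc k)
  show ?case
    by (rule Ck_on_SucI[OF Suc.prems has_derivative_const Suc.IH[OF Suc.prems]])
qed

lemma Ck_on_bounded_linear:
  assumes "open S" "bounded_linear L"
  shows "Ck_on k S L"
proof (cases k)
  case (Suc j)
  have "Ck_on (Suc j) S L"
    by (rule Ck_on_SucI[where f' = "\<lambda>_. L"])
      (rule assms(1) bounded_linear_imp_has_derivative[OF assms(2)] Ck_on_const[OF assms(1)])+
  then show ?thesis using Suc by simp
qed (use assms in \<open>simp add: linear_continuous_on\<close>)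

lemma Ck_on_diff:
  assumes "open S" "Ck_on k S f" "Ck_on k S g"
  shows "Ck_on k S (\<lambda>x. f x - g x)"
  using Ck_on_add[OF assms(1,2) Ck_on_linear[OF assms(1) bounded_linear_minus[OF bounded_linear_ident] assms(3)]]
  by (simp only: diff_conv_add_uminus)

text \<open>The derivative \<open>- (1/f) f' (1/f)\<close> involves \<open>1/f\<close> itself
  without derivatives, so regularity climbs one order at a time.\<close>

lemma Ck_on_inverse:
  fixes f :: "'e::real_normed_vector \<Rightarrow> real"
  assumes "open S" "Ck_on k S f" "\<And>x. x \<in> S \<Longrightarrow> f x \<noteq> 0"
  shows "Ck_on k S (\<lambda>x. inverse (f x))"
  using assms(2)
proof (induction k)
  case 0
  then show ?case using assms(3) by (simp add: continuous_on_inverse)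
next
  case (Suc k)
  obtain f' where f': "\<And>x. x \<in> S \<Longrightarrow> (f has_derivative f' x) (at x)" "\<And>v. Ck_on k S (\<lambda>x. f' x v)"
    using Ck_on_SucD[OF Suc.prems(1)] by blast
  note k = Suc.IH[OF Ck_on_lower[OF Suc.prems]]
  show ?case
  proof (rule Ck_on_SucI[OF assms(1) Deriv.has_derivative_inverse[OF assms(3) f'(1)]])
    show "Ck_on k S (\<lambda>x. - (inverse (f x) * f' x v * inverse (f x)))" for v
      using Ck_on_diff[OF assms(1) Ck_on_const[OF assms(1), of k 0] Ck_on_mult[OF assms(1) Ck_on_mult[OF assms(1) k f'(2)] k]]
      by simp
  qed
qed

text \<open>Both functions share one induction because the derivative of each contains the
  other.\<close>

lemma Ck_on_sin_cos:
  fixes f :: "'e::real_normed_vector \<Rightarrow> real"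
  assumes "open S" "Ck_on k S f"
  shows "Ck_on k S (\<lambda>x. sin (f x)) \<and> Ck_on k S (\<lambda>x. cos (f x))"
  using assms(2)
proof (induction k)
  case 0
  then show ?case by (simp add: continuous_on_sin continuous_on_cos)
next
  case (Suc k)
  obtain f' where f': "\<And>x. x \<in> S \<Longrightarrow> (f has_derivative f' x) (at x)" "\<And>v. Ck_on k S (\<lambda>x. f' x v)"
    using Ck_on_SucD[OF Suc.prems(1)] by blast
  note k = Suc.IH[OF Ck_on_lower[OF Suc.prems]]
  have "Ck_on k S (\<lambda>x. f' x v * - sin (f x))" for v
    using Ck_on_diff[OF assms(1) Ck_on_const[OF assms(1), of k 0] Ck_on_mult[OF assms(1) f'(2)[of v] conjunct1[OF k]]]
    by simp
  then show ?case
    using Ck_on_mult[OF assms(1) f'(2) conjunct2[OF k]]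
    by (auto intro!: Ck_on_SucI[OF assms(1) has_derivative_sin[OF f'(1)]] Ck_on_SucI[OF assms(1) has_derivative_cos[OF f'(1)]]
        simp del: Ck_on.simps(2))
qed

section \<open>Smooth cutoff functions\<close>

definition flat :: "real poly \<Rightarrow> real \<Rightarrow> real" where
  "flat q x = (if x > 0 then poly q (inverse x) * exp (- inverse x) else 0)"

lemma flat_tendsto: "((\<lambda>x. poly q (inverse x) * exp (- inverse x)) \<longlongrightarrow> 0) (at_right (0::real))"
proof -
  have "((\<lambda>y::real. poly q y * exp (- y)) \<longlongrightarrow> 0) at_top"
  proof (induction q)
    case (pCons a q)
    have "((\<lambda>y::real. poly r y * exp (- y)) \<longlongrightarrow> 0) at_top" for r
    proof -
      have "((\<lambda>y::real. \<Sum>i\<le>degree r. coeff r i * (y ^ i * exp (- y))) \<longlongrightarrow> (\<Sum>i\<le>degree r. coeff r i * 0)) at_top"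
        using tendsto_power_div_exp_0
        by (intro tendsto_sum tendsto_mult tendsto_const) (auto simp: exp_minus field_simps)
      then show ?thesis by (simp add: poly_altdef sum_distrib_right mult.assoc)
    qed
    then show ?case .
  qed auto
  from filterlim_compose[OF this filterlim_inverse_at_top_right] show ?thesis .
qed

text \<open>With \<open>y = 1/x\<close>, differentiation turns the polynomial \<open>q(y)\<close>
  into \<open>y^2 (q(y) - q'(y))\<close>. The family \<open>flat\<close> is thus stable under
  derivatives, and smoothness follows by induction with \<open>q\<close> arbitrary.\<close>

lemma flat_has_derivative:
  "(flat q has_real_derivative flat (monom 1 2 * (q - pderiv q)) x) (at x)"
proof -
  consider "x > 0" | "x < 0" | "x = 0" by linarith
  then show ?thesis
  proof cases
    case 1
    have "((\<lambda>x. poly q (inverse x) * exp (- inverse x)) has_real_derivative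
        flat (monom 1 2 * (q - pderiv q)) x) (at x)"
      using 1 by (auto intro!: derivative_eq_intros
          simp: flat_def poly_monom field_simps power2_eq_square)
    then show ?thesis
      by (rule has_field_derivative_transform_within_open[of _ _ _ "{0<..}"]) (use 1 in \<open>auto simp: flat_def\<close>)
  next
    case 2
    have "((\<lambda>x. 0) has_real_derivative flat (monom 1 2 * (q - pderiv q)) x) (at x)"
      using 2 by (auto simp: flat_def)
    then show ?thesis
      by (rule has_field_derivative_transform_within_open[of _ _ _ "{..<0}"]) (use 2 in \<open>auto simp: flat_def\<close>)
  next
    case 3
    \<comment> \<open>Dividing by \<open>h\<close> multiplies the polynomial in \<open>1/h\<close>
      by its variable, which gives \<open>pCons 0 q\<close>.\<close>
    have "((\<lambda>h. flat q h / h) \<longlongrightarrow> 0) (at_right 0)"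
      using flat_tendsto[of "pCons 0 q"]
      by (rule Lim_transform_eventually)
        (auto simp: flat_def field_simps eventually_at_right_field intro!: exI[of _ 1])
    moreover have "((\<lambda>h. flat q h / h) \<longlongrightarrow> 0) (at_left 0)"
      by (rule Lim_transform_eventually[OF tendsto_const])
        (auto simp: flat_def eventually_at_left_field intro!: exI[of _ "-1"])
    ultimately have "((\<lambda>h. flat q h / h) \<longlongrightarrow> 0) (at 0)"
      by (rule filterlim_split_at[rotated])
    then show ?thesis using 3 by (simp add: DERIV_def flat_def)
  qed
qed

lemma Ck_on_flat:
  fixes f :: "'e::real_normed_vector \<Rightarrow> real"
  assumes "open S" "Ck_on k S f"
  shows "Ck_on k S (\<lambda>x. flat q (f x))"
  using assms(2)
proof (induction k arbitrary: q)
  case 0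
  have "continuous_on UNIV (flat q)"
    using flat_has_derivative DERIV_continuous_on by blast
  then show ?case using 0 continuous_on_compose2[of UNIV "flat q" S f] by auto
next
  case (Suc k)
  obtain f' where f': "\<And>x. x \<in> S \<Longrightarrow> (f has_derivative f' x) (at x)" "\<And>v. Ck_on k S (\<lambda>x. f' x v)"
    using Ck_on_SucD[OF Suc.prems(1)] by blast
  show ?case
  proof (rule Ck_on_SucI[OF assms(1)])
    show "((\<lambda>x. flat q (f x)) has_derivative
        (\<lambda>v. f' x v * flat (monom 1 2 * (q - pderiv q)) (f x))) (at x)" if "x \<in> S" for x
      using DERIV_compose_FDERIV[OF flat_has_derivative f'(1)[OF that]] .
  qed (intro Ck_on_mult assms(1) f' Suc.IH Ck_on_lower[OF Suc.prems])
qed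

text \<open>The standard quotient of flat functions. For \<open>a < b\<close> the two summands of
  the denominator never vanish together.\<close>

definition smooth_step :: "real \<Rightarrow> real \<Rightarrow> real \<Rightarrow> real" where
  "smooth_step a b x = flat 1 (x - a) / (flat 1 (x - a) + flat 1 (b - x))"

lemma smooth_step:
  assumes "a < b"
  shows smooth_step_denom: "flat 1 (x - a) + flat 1 (b - x) > 0"
    and smooth_step_nonneg: "0 \<le> smooth_step a b x"
    and smooth_step_le_1: "smooth_step a b x \<le> 1"
    and smooth_step_eq_0: "x \<le> a \<Longrightarrow> smooth_step a b x = 0"
    and smooth_step_eq_1: "b \<le> x \<Longrightarrow> smooth_step a b x = 1"
proof -
  show *: "flat 1 (x - a) + flat 1 (b - x) > 0"
    using assms by (auto simp: flat_def add_pos_pos)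
  show "0 \<le> smooth_step a b x" "smooth_step a b x \<le> 1"
     "x \<le> a \<Longrightarrow> smooth_step a b x = 0" "b \<le> x \<Longrightarrow> smooth_step a b x = 1"
    using assms * by (auto simp: smooth_step_def flat_def)
qed

lemma Ck_on_smooth_step:
  assumes "a < b" "open S" "Ck_on k S f"
  shows "Ck_on k S (\<lambda>x. smooth_step a b (f x))"
proof -
  have 1: "Ck_on k S (\<lambda>x. flat 1 (f x - a))"
    by (intro Ck_on_flat Ck_on_diff Ck_on_const assms)
  moreover have 2: "Ck_on k S (\<lambda>x. flat 1 (b - f x))"
    by (intro Ck_on_flat Ck_on_diff Ck_on_const assms)
  ultimately have "Ck_on k S (\<lambda>x. flat 1 (f x - a) * inverse (flat 1 (f x - a) + flat 1 (b - f x)))"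
    using smooth_step_denom[OF assms(1)]
    by (intro Ck_on_mult Ck_on_inverse Ck_on_add assms) (auto simp: less_imp_neq[symmetric])
  then show ?thesis by (simp add: smooth_step_def divide_inverse)
qed

section \<open>Differentiability of quasi-inverses\<close>

lemma has_derivative_mult_vanishing:
  fixes c g :: "'e::real_normed_vector \<Rightarrow> 'a::real_normed_algebra"
  assumes "isCont c x" "(g has_derivative g') (at x)" "g x = 0"
  shows "((\<lambda>y. c y * g y) has_derivative (\<lambda>v. c x * g' v)) (at x)"
proof -
  \<comment> \<open>Continuity of \<open>c\<close> suffices: \<open>g y\<close> is of order
    \<open>norm (y - x)\<close> because \<open>g x = 0\<close>, and the increment of
    \<open>c\<close> tends to 0, so their product is a remainder term.\<close>
  have "((\<lambda>y. (c y - c x) * g y) has_derivative (\<lambda>v. 0)) (at x)"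
    unfolding has_derivative_at_alt
  proof (intro conjI allI impI)
    fix e :: real assume "0 < e"
    obtain K where K: "0 < K" "\<And>v. norm (g' v) \<le> norm v * K"
      using bounded_linear.pos_bounded[OF has_derivative_bounded_linear[OF assms(2)]] by blast
    obtain d1 where d1: "0 < d1" "\<And>y. norm (y - x) < d1 \<Longrightarrow> norm (g y - g x - g' (y - x)) \<le> 1 * norm (y - x)"
      using assms(2) unfolding has_derivative_at_alt by (metis zero_less_one)
    \<comment> \<open>Near \<open>x\<close> the norm of \<open>g y\<close> is at most
      \<open>(K + 1) * norm (y - x)\<close>: \<open>K\<close> comes from the derivative, 1 from the
      remainder.\<close>
    have "0 < e / (K + 1)" using \<open>0 < e\<close> K(1) by simp
    then obtain d2 where d2: "0 < d2" "\<And>y. norm (y - x) < d2 \<Longrightarrow> norm (c y - c x) < e / (K + 1)"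
      using assms(1) unfolding continuous_at_eps_delta dist_norm by metis
    show "\<exists>d>0. \<forall>y. norm (y - x) < d \<longrightarrow>
        norm ((c y - c x) * g y - (c x - c x) * g x - 0) \<le> e * norm (y - x)"
    proof (intro exI[of _ "min d1 d2"] conjI allI impI)
      fix y assume y: "norm (y - x) < min d1 d2"
      have "norm (g y) \<le> norm (g y - g' (y - x)) + norm (g' (y - x))"
        using norm_triangle_ineq[of "g y - g' (y - x)" "g' (y - x)"] by simp
      also have "\<dots> \<le> (K + 1) * norm (y - x)"
        using d1(2)[of y] K(2)[of "y - x"] y assms(3) by (simp add: algebra_simps)
      finally have "norm (c y - c x) * norm (g y) \<le> e / (K + 1) * ((K + 1) * norm (y - x))"
        using d2(2)[of y] y K(1) \<open>0 < e\<close> by (intro mult_mono) auto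
      also have "\<dots> = e * norm (y - x)" using K(1) by simp
      finally show "norm ((c y - c x) * g y - (c x - c x) * g x - 0) \<le> e * norm (y - x)"
        by (auto intro: order_trans[OF norm_mult_ineq])
    qed (use d1(1) d2(1) in auto)
  qed simp
  from has_derivative_add[OF this has_derivative_mult_right[OF assms(2), of "c x"]]
  show ?thesis by (simp add: left_diff_distrib)
qed

text \<open>The resolvent identity \<open>D y - D x = (1 + D y) (F y - F x) (1 + D x)\<close> with
  the unit multiplied out; \<open>1 + D\<close> plays the inverse of \<open>1 - F\<close>.\<close>

lemma quasi_inverse_diff:
  fixes F :: "'e \<Rightarrow> 'a::ring"
  assumes "D y = F y + D y * F y" "D x = F x + F x * D x"
  shows "D y - D x = ((F y - F x) + D y * (F y - F x)) + ((F y - F x) + D y * (F y - F x)) * D x"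
proof -
  have 1: "D y * F y = D y - F y" and 2: "F x * D x = D x - F x"
    using assms by (simp_all add: algebra_simps)
  have 3: "D y * (F y * D x) = D y * D x - F y * D x"
    using arg_cong[OF 1, of "\<lambda>z. z * D x"] by (simp add: algebra_simps)
  show ?thesis by (simp add: algebra_simps 1 2 3)
qed

text \<open>The resolvent identity gives the derivative \<open>(1 + D) F' (1 + D)\<close>. It is of
  class \<open>C^k\<close> once \<open>D\<close> is, so mere continuity of \<open>D\<close> starts a
  bootstrap that ends at the regularity of \<open>F\<close>.\<close>

lemma Ck_on_quasi_inverse:
  fixes F :: "'e::real_normed_vector \<Rightarrow> 'a::real_normed_algebra"
  assumes "open S" "Ck_on k S F" "continuous_on S D"
    and "\<And>x. x \<in> S \<Longrightarrow> D x = F x + F x * D x" "\<And>x. x \<in> S \<Longrightarrow> D x = F x + D x * F x"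
  shows "Ck_on k S D"
  using assms(2)
proof (induction k)
  case 0
  then show ?case using assms(3) by simp
next
  case (Suc k)
  obtain F' where F': "\<And>x. x \<in> S \<Longrightarrow> (F has_derivative F' x) (at x)" "\<And>v. Ck_on k S (\<lambda>x. F' x v)"
    using Ck_on_SucD[OF Suc.prems] by blast
  note D = Suc.IH[OF Ck_on_lower[OF Suc.prems]]
  let ?A = "\<lambda>x v. F' x v + D x * F' x v"
  show ?case
  proof (rule Ck_on_SucI[OF assms(1)])
    fix x assume x: "x \<in> S"
    have c: "isCont D x" using assms(1,3) x by (simp add: continuous_on_eq_continuous_at)
    have dF: "((\<lambda>y. F y - F x) has_derivative F' x) (at x)"
      using has_derivative_diff[OF F'(1)[OF x] has_derivative_const, of "F x"] by simp
    note dA = has_derivative_add[OF dF has_derivative_mult_vanishing[OF c dF]]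
    have "((\<lambda>y. D x + (((F y - F x) + D y * (F y - F x)) + ((F y - F x) + D y * (F y - F x)) * D x))
        has_derivative (\<lambda>v. 0 + (?A x v + ?A x v * D x))) (at x)"
      by (intro has_derivative_add has_derivative_const has_derivative_mult_left dA) auto
    then have "((\<lambda>y. D x + (((F y - F x) + D y * (F y - F x)) + ((F y - F x) + D y * (F y - F x)) * D x))
        has_derivative (\<lambda>v. ?A x v + ?A x v * D x)) (at x)" by simp
    then show "(D has_derivative (\<lambda>v. ?A x v + ?A x v * D x)) (at x)"
    proof (rule has_derivative_transform_within_open[OF _ assms(1) x])
      fix y assume "y \<in> S"
      note eq = quasi_inverse_diff[of D y F x, OF assms(5)[OF this] assms(4)[OF x]]
      show "D x + (((F y - F x) + D y * (F y - F x)) + ((F y - F x) + D y * (F y - F x)) * D x) = D y"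
        unfolding eq[symmetric] by simp
    qed
  next
    show "Ck_on k S (\<lambda>x. ?A x v + ?A x v * D x)" for v
      by (intro Ck_on_add Ck_on_mult assms(1) F'(2) D)
  qed
qed

section \<open>Bounds on derivatives\<close>

lemma compact_bounded_combinations:
  fixes E :: "'e::real_normed_vector set"
  assumes "finite E"
  shows "compact {\<Sum>x\<in>E. a x *\<^sub>R x |a. \<forall>x\<in>E. \<bar>a x\<bar> \<le> L}"
  using assms
proof (induction E)
  case empty
  then show ?case by simp
next
  case (insert e E)
  let ?K = "{\<Sum>x\<in>E. a x *\<^sub>R x |a. \<forall>x\<in>E. \<bar>a x\<bar> \<le> L}"
  have "{\<Sum>x\<in>insert e E. a x *\<^sub>R x |a. \<forall>x\<in>insert e E. \<bar>a x\<bar> \<le> L}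
      = (\<lambda>(t, w). t *\<^sub>R e + w) ` ({-L..L} \<times> ?K)" (is "?A = ?B")
  proof
    show "?A \<subseteq> ?B"
    proof
      fix v assume "v \<in> ?A"
      then obtain a where a: "v = (\<Sum>x\<in>insert e E. a x *\<^sub>R x)" "\<forall>x\<in>insert e E. \<bar>a x\<bar> \<le> L" by blast
      then have "v = a e *\<^sub>R e + (\<Sum>x\<in>E. a x *\<^sub>R x)" "\<bar>a e\<bar> \<le> L" using insert by auto
      then show "v \<in> ?B" using a(2)
        by (intro image_eqI[of _ _ "(a e, \<Sum>x\<in>E. a x *\<^sub>R x)"]) auto
    qed
    show "?B \<subseteq> ?A"
    proof
      fix v assume "v \<in> ?B"
      then obtain t a where a: "v = t *\<^sub>R e + (\<Sum>x\<in>E. a x *\<^sub>R x)" "\<bar>t\<bar> \<le> L" "\<forall>x\<in>E. \<bar>a x\<bar> \<le> L" by auto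
      have "(\<Sum>x\<in>E. (a(e := t)) x *\<^sub>R x) = (\<Sum>x\<in>E. a x *\<^sub>R x)"
        using insert by (intro sum.cong) auto
      then have "v = (\<Sum>x\<in>insert e E. (a(e := t)) x *\<^sub>R x)" using insert a(1) by simp
      then show "v \<in> ?A" using a by (intro CollectI exI[of _ "a(e := t)"]) auto
    qed
  qed
  moreover have "compact ?B"
    using insert.IH
    by (intro compact_continuous_image compact_Times) (auto intro!: continuous_intros simp: case_prod_unfold)
  ultimately show ?case by simp
qed

text \<open>The model space has a finite spanning set but no inner product or fixed basis, so
  control of coordinates by the norm is obtained by adding one vector at a time. A new vector
  outside the span has positive distance to it; a vector already in the span gets coordinate
  0.\<close>

lemma span_coordinate_bound:
  fixes E :: "'e::real_normed_vector set"
  assumes "finite E"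
  shows "\<exists>C\<ge>0. \<forall>v\<in>span E. \<exists>a. v = (\<Sum>x\<in>E. a x *\<^sub>R x) \<and> (\<Sum>x\<in>E. \<bar>a x\<bar>) \<le> C * norm v"
  using assms
proof (induction E)
  case empty
  then show ?case by (intro exI[of _ 0]) auto
next
  case (insert e E)
  then obtain C where C: "C \<ge> 0"
    "\<And>v. v \<in> span E \<Longrightarrow> \<exists>a. v = (\<Sum>x\<in>E. a x *\<^sub>R x) \<and> (\<Sum>x\<in>E. \<bar>a x\<bar>) \<le> C * norm v" by blast
  have upd: "(\<Sum>x\<in>insert e E. (a(e := t)) x *\<^sub>R x) = t *\<^sub>R e + (\<Sum>x\<in>E. a x *\<^sub>R x)"
      "(\<Sum>x\<in>insert e E. \<bar>(a(e := t)) x\<bar>) = \<bar>t\<bar> + (\<Sum>x\<in>E. \<bar>a x\<bar>)" for a :: "'e \<Rightarrow> real" and t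
    using insert by (auto intro!: sum.cong)
  show ?case
  proof (cases "e \<in> span E")
    case True
    then have span_eq: "span (insert e E) = span E" by (rule span_redundant)
    show ?thesis unfolding span_eq
    proof (intro exI[of _ C] conjI ballI C(1))
      fix v assume "v \<in> span E"
      then obtain a where a: "v = (\<Sum>x\<in>E. a x *\<^sub>R x)" "(\<Sum>x\<in>E. \<bar>a x\<bar>) \<le> C * norm v" using C(2) by blast
      then show "\<exists>a. v = (\<Sum>x\<in>insert e E. a x *\<^sub>R x) \<and> (\<Sum>x\<in>insert e E. \<bar>a x\<bar>) \<le> C * norm v"
        by (intro exI[of _ "a(e := 0)"]) (simp only: upd, simp)
    qed
  next
    case False
    \<comment> \<open>\<open>L\<close> bounds the coordinates of all \<open>w\<close> in the span
      with \<open>norm w \<le> 2 * norm e\<close>. These lie in a compact set; any longer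
      \<open>w\<close> has distance at least \<open>norm e\<close> from \<open>e\<close>
      anyway.\<close>
    define L where "L = C * (2 * norm e)"
    define K where "K = {\<Sum>x\<in>E. a x *\<^sub>R x |a. \<forall>x\<in>E. \<bar>a x\<bar> \<le> L}"
    have "K \<subseteq> span E" by (auto simp: K_def intro!: span_sum intro: span_scale span_base)
    moreover have "closed K" unfolding K_def
      by (intro compact_imp_closed compact_bounded_combinations insert)
    ultimately have "open (- K)" "e \<in> - K" using False by auto
    then obtain d where d: "d > 0" "ball e d \<subseteq> - K" unfolding open_contains_ball by blast
    then have d: "d > 0" "\<And>w. w \<in> K \<Longrightarrow> d \<le> dist e w" by (auto simp: subset_iff not_less[symmetric])
    define d' where "d' = min d (norm e)"
    have "e \<noteq> 0" using False span_zero by blast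
    then have "d' > 0" using d by (simp add: d'_def)
    have far: "d' \<le> norm (e - w)" if w: "w \<in> span E" for w
    proof (cases "norm w \<le> 2 * norm e")
      case True
      obtain a where a: "w = (\<Sum>x\<in>E. a x *\<^sub>R x)" "(\<Sum>x\<in>E. \<bar>a x\<bar>) \<le> C * norm w" using C(2) w by blast
      have "\<bar>a x\<bar> \<le> L" if "x \<in> E" for x
      proof -
        have "\<bar>a x\<bar> \<le> (\<Sum>x\<in>E. \<bar>a x\<bar>)" using that insert by (intro member_le_sum) auto
        also have "\<dots> \<le> L" unfolding L_def using a(2) mult_left_mono[OF True C(1)] by linarith
        finally show ?thesis .
      qed
      then have "w \<in> K" using a(1) by (auto simp: K_def)
      then show ?thesis using d(2)[of w] by (simp add: d'_def dist_norm)
    next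
      case False
      then show ?thesis using norm_triangle_ineq2[of w e] by (simp add: d'_def norm_minus_commute)
    qed
    show ?thesis
    proof (intro exI[of _ "1 / d' + C * (1 + norm e / d')"] conjI ballI)
      show "0 \<le> 1 / d' + C * (1 + norm e / d')" using \<open>d' > 0\<close> C(1) by simp
      fix v assume "v \<in> span (insert e E)"
      then obtain t where t: "v - t *\<^sub>R e \<in> span E" unfolding span_breakdown_eq by blast
      \<comment> \<open>For \<open>t\<close> nonzero, \<open>v / t\<close> is \<open>e\<close> minus
        an element of \<open>span E\<close>, so its norm is at least \<open>d'\<close>.\<close>
      have "\<bar>t\<bar> * d' \<le> norm v"
      proof (cases "t = 0")
        case False
        have "- (inverse t) *\<^sub>R (v - t *\<^sub>R e) \<in> span E" by (rule span_scale[OF t])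
        from far[OF this] have "d' \<le> norm (inverse t *\<^sub>R v)" using False by (simp add: algebra_simps)
        then show ?thesis using False by (simp add: field_simps)
      qed auto
      then have t': "\<bar>t\<bar> \<le> norm v / d'" using \<open>d' > 0\<close> by (simp add: field_simps)
      obtain a where a: "v - t *\<^sub>R e = (\<Sum>x\<in>E. a x *\<^sub>R x)" "(\<Sum>x\<in>E. \<bar>a x\<bar>) \<le> C * norm (v - t *\<^sub>R e)"
        using C(2) t by blast
      have "norm (v - t *\<^sub>R e) \<le> norm v + \<bar>t\<bar> * norm e" using norm_triangle_ineq4[of v "t *\<^sub>R e"] by simp
      also have "\<dots> \<le> norm v + norm v / d' * norm e" by (intro add_left_mono mult_right_mono t') auto
      finally have "C * norm (v - t *\<^sub>R e) \<le> C * (norm v + norm v / d' * norm e)" by (rule mult_left_mono[OF _ C(1)])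
      then have "\<bar>t\<bar> + (\<Sum>x\<in>E. \<bar>a x\<bar>) \<le> norm v / d' + C * (norm v + norm v / d' * norm e)"
        using t' a(2) by linarith
      also have "\<dots> = (1 / d' + C * (1 + norm e / d')) * norm v" by (simp add: algebra_simps)
      finally show "\<exists>a. v = (\<Sum>x\<in>insert e E. a x *\<^sub>R x) \<and>
          (\<Sum>x\<in>insert e E. \<bar>a x\<bar>) \<le> (1 / d' + C * (1 + norm e / d')) * norm v"
        using a(1) by (intro exI[of _ "a(e := t)"]) (simp only: upd, simp add: algebra_simps)
    qed
  qed
qed

text \<open>The quantitative companion of \<open>Ck_on\<close>: one constant bounds the function and
  its iterated derivatives of order up to \<open>k\<close> along directions from the unit ball.
  Keeping the constant explicit is what permits summation over \<open>n\<close>.\<close>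

fun Ck_bdd :: "nat \<Rightarrow> 'e::real_normed_vector set \<Rightarrow> ('e \<Rightarrow> 'f::real_normed_vector) \<Rightarrow> real \<Rightarrow> bool" where
  "Ck_bdd 0 S f M \<longleftrightarrow> continuous_on S f \<and> (\<forall>x\<in>S. norm (f x) \<le> M)"
| "Ck_bdd (Suc k) S f M \<longleftrightarrow> (\<forall>x\<in>S. f differentiable (at x)) \<and> (\<forall>x\<in>S. norm (f x) \<le> M)
     \<and> (\<forall>v. norm v \<le> 1 \<longrightarrow> Ck_bdd k S (\<lambda>x. frechet_derivative f (at x) v) M)"

lemma Ck_bdd_cong:
  assumes "open S" "\<And>x. x \<in> S \<Longrightarrow> f x = g x" "Ck_bdd k S f M"
  shows "Ck_bdd k S g M"
  using assms(2,3)
proof (induction k arbitrary: f g)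
  case 0
  then show ?case by (auto cong: continuous_on_cong)
next
  case (Suc k)
  have d: "(g has_derivative frechet_derivative f (at x)) (at x)" if "x \<in> S" for x
  proof (rule has_derivative_transform_within_open[OF _ assms(1) that Suc.prems(1)])
    show "(f has_derivative frechet_derivative f (at x)) (at x)"
      using Suc.prems(2) that by (simp add: frechet_derivative_works[symmetric])
  qed
  have "Ck_bdd k S (\<lambda>x. frechet_derivative g (at x) v) M" if v: "norm v \<le> 1" for v
  proof (rule Suc.IH)
    show "frechet_derivative f (at x) v = frechet_derivative g (at x) v" if "x \<in> S" for x
      using frechet_derivative_at[OF d[OF that]] by simp
  qed (use Suc.prems(2) v in simp)
  moreover have "\<forall>x\<in>S. g differentiable (at x)" using d differentiableI by blast
  ultimately show ?case using Suc.prems by simp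
qed

lemma Ck_bdd_SucI:
  assumes "open S" "\<And>x. x \<in> S \<Longrightarrow> (f has_derivative f' x) (at x)"
    and "\<And>x. x \<in> S \<Longrightarrow> norm (f x) \<le> M"
    and "\<And>v. norm v \<le> 1 \<Longrightarrow> Ck_bdd k S (\<lambda>x. f' x v) M"
  shows "Ck_bdd (Suc k) S f M"
proof -
  have "Ck_bdd k S (\<lambda>x. frechet_derivative f (at x) v) M" if "norm v \<le> 1" for v
    by (rule Ck_bdd_cong[OF assms(1) _ assms(4)[OF that]]) (use frechet_derivative_at[OF assms(2)] in simp)
  moreover have "\<forall>x\<in>S. f differentiable (at x)" using assms(2) differentiableI by blast
  ultimately show ?thesis using assms(3) by simp
qed

lemma Ck_bdd_SucD:
  assumes "Ck_bdd (Suc k) S f M"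
  shows "\<exists>f'. (\<forall>x\<in>S. (f has_derivative f' x) (at x)) \<and> (\<forall>v. norm v \<le> 1 \<longrightarrow> Ck_bdd k S (\<lambda>x. f' x v) M)"
  using assms by (intro exI[of _ "\<lambda>x. frechet_derivative f (at x)"]) (auto simp: frechet_derivative_works)

lemma Ck_bdd_norm_le: "Ck_bdd k S f M \<Longrightarrow> x \<in> S \<Longrightarrow> norm (f x) \<le> M"
  by (cases k) auto

lemma Ck_bdd_continuous: "Ck_bdd k S f M \<Longrightarrow> continuous_on S f"
  by (cases k) (auto intro!: continuous_at_imp_continuous_on differentiable_imp_continuous_within)

lemma Ck_bdd_lower: "Ck_bdd (Suc k) S f M \<Longrightarrow> Ck_bdd k S f M"
proof (induction k arbitrary: f)
  case 0
  then show ?case using Ck_bdd_continuous[OF 0] by simp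
qed auto

lemma Ck_bdd_mono: "Ck_bdd k S f M \<Longrightarrow> M \<le> N \<Longrightarrow> Ck_bdd k S f N"
  by (induction k arbitrary: f) (auto intro: order_trans)

lemma Ck_bdd_subset: "Ck_bdd k S f M \<Longrightarrow> T \<subseteq> S \<Longrightarrow> Ck_bdd k T f M"
  by (induction k arbitrary: f) (auto intro: continuous_on_subset)

lemma Ck_bdd_add:
  assumes "open S" "Ck_bdd k S f M" "Ck_bdd k S g N"
  shows "Ck_bdd k S (\<lambda>x. f x + g x) (M + N)"
  using assms(2,3)
proof (induction k arbitrary: f g)
  case 0
  then show ?case by (auto intro!: continuous_on_add norm_triangle_mono)
next
  case (Suc k)
  obtain f' where f': "\<And>x. x \<in> S \<Longrightarrow> (f has_derivative f' x) (at x)"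
      "\<And>v. norm v \<le> 1 \<Longrightarrow> Ck_bdd k S (\<lambda>x. f' x v) M"
    using Ck_bdd_SucD[OF Suc.prems(1)] by blast
  obtain g' where g': "\<And>x. x \<in> S \<Longrightarrow> (g has_derivative g' x) (at x)"
      "\<And>v. norm v \<le> 1 \<Longrightarrow> Ck_bdd k S (\<lambda>x. g' x v) N"
    using Ck_bdd_SucD[OF Suc.prems(2)] by blast
  show ?case
  proof (rule Ck_bdd_SucI[OF assms(1) has_derivative_add[OF f'(1) g'(1)]])
    show "norm (f x + g x) \<le> M + N" if "x \<in> S" for x
      using Suc.prems that by (auto intro: norm_triangle_mono)
  qed (auto intro: Suc.IH f' g')
qed

lemma Ck_bdd_linear:
  assumes "open S" "bounded_linear L" "\<And>x. norm (L x) \<le> B * norm x" "0 \<le> B" "Ck_bdd k S f M"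
  shows "Ck_bdd k S (\<lambda>x. L (f x)) (B * M)"
  using assms(5)
proof (induction k arbitrary: f)
  case 0
  then show ?case using assms(3,4)
    by (auto intro!: bounded_linear.continuous_on[OF assms(2)] intro: order_trans[OF _ mult_left_mono])
next
  case (Suc k)
  obtain f' where f': "\<And>x. x \<in> S \<Longrightarrow> (f has_derivative f' x) (at x)"
      "\<And>v. norm v \<le> 1 \<Longrightarrow> Ck_bdd k S (\<lambda>x. f' x v) M"
    using Ck_bdd_SucD[OF Suc.prems(1)] by blast
  show ?case
  proof (rule Ck_bdd_SucI[OF assms(1) bounded_linear.has_derivative[OF assms(2) f'(1)]])
    show "norm (L (f x)) \<le> B * M" if "x \<in> S" for x
      using Suc.prems that assms(3,4) by (auto intro: order_trans[OF _ mult_left_mono])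
  qed (auto intro: Suc.IH f')
qed

lemma Ck_bdd_scaleR:
  assumes "open S" "Ck_bdd k S f M"
  shows "Ck_bdd k S (\<lambda>x. c *\<^sub>R f x) (\<bar>c\<bar> * M)"
  by (rule Ck_bdd_linear[OF assms(1) bounded_linear_scaleR_right _ _ assms(2)]) auto

lemma Ck_bdd_zero: "open S \<Longrightarrow> Ck_bdd k S (\<lambda>x. 0) 0"
proof (induction k)
  case (Suc k)
  show ?case
    by (rule Ck_bdd_SucI[OF Suc.prems has_derivative_const _ Suc.IH[OF Suc.prems]]) simp
qed simp

lemma Ck_bdd_sum:
  assumes "open S" "finite I" "\<And>i. i \<in> I \<Longrightarrow> Ck_bdd k S (f i) (M i)"
  shows "Ck_bdd k S (\<lambda>x. \<Sum>i\<in>I. f i x) (\<Sum>i\<in>I. M i)"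
  using assms(2,3)
proof (induction I)
  case empty
  then show ?case using Ck_bdd_zero[OF assms(1)] by simp
next
  case (insert i I)
  then show ?case using Ck_bdd_add[OF assms(1), of k "f i" "M i"] by simp
qed

text \<open>The product rule doubles the number of terms at each order, hence the factor
  \<open>2 ^ k\<close>.\<close>

lemma Ck_bdd_mult:
  fixes f g :: "'e::real_normed_vector \<Rightarrow> 'f::real_normed_algebra"
  assumes "open S" "Ck_bdd k S f M" "Ck_bdd k S g N"
  shows "Ck_bdd k S (\<lambda>x. f x * g x) (2 ^ k * (M * N))"
  using assms(2,3)
proof (induction k arbitrary: f g)
  case 0
  have "norm (f x * g x) \<le> M * N" if "x \<in> S" for x
    using 0 that by (intro order_trans[OF norm_mult_ineq mult_mono']) auto
  then show ?case using 0 by (auto intro!: continuous_on_mult)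
next
  case (Suc k)
  obtain f' where f': "\<And>x. x \<in> S \<Longrightarrow> (f has_derivative f' x) (at x)"
      "\<And>v. norm v \<le> 1 \<Longrightarrow> Ck_bdd k S (\<lambda>x. f' x v) M"
    using Ck_bdd_SucD[OF Suc.prems(1)] by blast
  obtain g' where g': "\<And>x. x \<in> S \<Longrightarrow> (g has_derivative g' x) (at x)"
      "\<And>v. norm v \<le> 1 \<Longrightarrow> Ck_bdd k S (\<lambda>x. g' x v) N"
    using Ck_bdd_SucD[OF Suc.prems(2)] by blast
  show ?case
  proof (rule Ck_bdd_SucI[OF assms(1) has_derivative_mult[OF f'(1) g'(1)]])
    fix x assume x: "x \<in> S"
    have fg: "norm (f x) \<le> M" "norm (g x) \<le> N" using Suc.prems x by auto
    then have "norm (f x * g x) \<le> M * N"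
      by (intro order_trans[OF norm_mult_ineq mult_mono']) auto
    also have "\<dots> \<le> 2 ^ Suc k * (M * N)"
    proof -
      have "0 \<le> M * N" using fg by (meson mult_nonneg_nonneg norm_ge_zero order_trans)
      then show ?thesis using mult_right_mono[OF one_le_power[of "2::real" "Suc k"]] by fastforce
    qed
    finally show "norm (f x * g x) \<le> 2 ^ Suc k * (M * N)" .
  next
    fix v :: 'e assume v: "norm v \<le> 1"
    have "Ck_bdd k S (\<lambda>x. f x * g' x v + f' x v * g x) (2 ^ k * (M * N) + 2 ^ k * (M * N))"
      by (intro Ck_bdd_add assms(1) Suc.IH f' g' v Ck_bdd_lower[OF Suc.prems(1)] Ck_bdd_lower[OF Suc.prems(2)])
    moreover have "2 ^ k * (M * N) + 2 ^ k * (M * N) = 2 ^ Suc k * (M * N)" by simp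
    ultimately show "Ck_bdd k S (\<lambda>x. f x * g' x v + f' x v * g x) (2 ^ Suc k * (M * N))" by (simp only:)
  qed
qed

text \<open>The derivative is homogeneous in \<open>v\<close>, so the bound for the unit vector
  \<open>sgn v\<close> only has to be scaled.\<close>

lemma Ck_bdd_directional:
  assumes "open S" "Ck_bdd (Suc k) S f M"
  shows "Ck_bdd k S (\<lambda>x. frechet_derivative f (at x) v) (norm v * M)"
proof (rule Ck_bdd_cong[OF assms(1)])
  show "Ck_bdd k S (\<lambda>x. norm v *\<^sub>R frechet_derivative f (at x) (sgn v)) (norm v * M)"
    using Ck_bdd_scaleR[OF assms(1), of k "\<lambda>x. frechet_derivative f (at x) (sgn v)" M "norm v"] assms(2)
    by (simp add: norm_sgn)
  show "norm v *\<^sub>R frechet_derivative f (at x) (sgn v) = frechet_derivative f (at x) v" if "x \<in> S" for x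
  proof -
    have "linear (frechet_derivative f (at x))" using assms(2) that by (auto intro: linear_frechet_derivative)
    then have "norm v *\<^sub>R frechet_derivative f (at x) (sgn v) = frechet_derivative f (at x) (norm v *\<^sub>R sgn v)"
      by (simp only: linear_cmul)
    also have "norm v *\<^sub>R sgn v = v" by (cases "v = 0") (auto simp: sgn_div_norm)
    finally show ?thesis .
  qed
qed

text \<open>Finite dimension enters here: bounds along finitely many spanning vectors hold on one
  common neighbourhood, and \<open>span_coordinate_bound\<close> carries them to every direction of
  the unit ball. Otherwise the neighbourhood could shrink with the direction.\<close>

lemma Ck_on_locally_bdd:
  fixes S :: "'e::real_normed_vector set" and f :: "'e \<Rightarrow> 'f::real_normed_vector"
  assumes "\<exists>B::'e set. finite B \<and> span B = UNIV" "open S" "Ck_on k S f" "x \<in> S"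
  shows "\<exists>N M. open N \<and> x \<in> N \<and> N \<subseteq> S \<and> Ck_bdd k N f M"
proof -
  obtain E :: "'e set" where E: "finite E" "span E = UNIV" using assms(1) by blast
  obtain C where C: "C \<ge> 0"
    "\<And>v. \<exists>a. v = (\<Sum>x\<in>E. a x *\<^sub>R x) \<and> (\<Sum>x\<in>E. \<bar>a x\<bar>) \<le> C * norm v"
    using span_coordinate_bound[OF E(1)] E(2) by auto
  have cont: "\<exists>N M. open N \<and> x \<in> N \<and> N \<subseteq> S \<and> (\<forall>y\<in>N. norm (f y) \<le> M)" if "continuous_on S f" for f :: "'e \<Rightarrow> 'f"
  proof (intro exI conjI)
    show "open (S \<inter> f -` ball (f x) 1)"
      using continuous_open_preimage[OF that assms(2) open_ball] .
    show "x \<in> S \<inter> f -` ball (f x) 1" using assms(4) by simp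
    show "\<forall>y\<in>S \<inter> f -` ball (f x) 1. norm (f y) \<le> norm (f x) + 1"
    proof
      fix y assume "y \<in> S \<inter> f -` ball (f x) 1"
      then show "norm (f y) \<le> norm (f x) + 1"
        using norm_triangle_sub[of "f y" "f x"] by (simp add: dist_norm norm_minus_commute)
    qed
  qed auto
  show ?thesis using assms(3)
  proof (induction k arbitrary: f)
    case 0
    then show ?case using cont[of f] by (force intro: continuous_on_subset)
  next
    case (Suc k)
    let ?d = "\<lambda>e x. frechet_derivative f (at x) e"
    have "\<forall>e\<in>E. \<exists>N M. open N \<and> x \<in> N \<and> N \<subseteq> S \<and> Ck_bdd k N (?d e) M"
      using Suc.IH Suc.prems by simp
    then obtain N M where NM: "\<And>e. e \<in> E \<Longrightarrow> open (N e) \<and> x \<in> N e \<and> N e \<subseteq> S \<and> Ck_bdd k (N e) (?d e) (M e)"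
      by metis
    obtain N0 M0 where N0: "open N0" "x \<in> N0" "N0 \<subseteq> S" "\<forall>y\<in>N0. norm (f y) \<le> M0"
      using cont[OF Ck_on_continuous[OF Suc.prems]] by blast
    define N' where "N' = N0 \<inter> (\<Inter>e\<in>E. N e)"
    define M' where "M' = max M0 (C * (\<Sum>e\<in>E. \<bar>M e\<bar>))"
    have N': "open N'" "x \<in> N'" "N' \<subseteq> S" using N0 NM E(1)
      by (auto simp: N'_def intro!: open_Int open_INT)
    have der: "(f has_derivative frechet_derivative f (at y)) (at y)" if "y \<in> N'" for y
      using Suc.prems N'(3) that by (auto simp: frechet_derivative_works[symmetric])
    have "Ck_bdd (Suc k) N' f M'"
    proof (rule Ck_bdd_SucI[OF N'(1) der])
      show "norm (f y) \<le> M'" if "y \<in> N'" for y using N0(4) that by (auto simp: N'_def M'_def le_max_iff_disj)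
      fix v :: 'e assume v: "norm v \<le> 1"
      obtain a where a: "v = (\<Sum>e\<in>E. a e *\<^sub>R e)" "(\<Sum>e\<in>E. \<bar>a e\<bar>) \<le> C * norm v" using C(2) by blast
      have "Ck_bdd k N' (\<lambda>y. \<Sum>e\<in>E. a e *\<^sub>R ?d e y) (\<Sum>e\<in>E. \<bar>a e\<bar> * M e)"
        by (intro Ck_bdd_sum Ck_bdd_scaleR N'(1) E(1)) (use NM in \<open>auto simp: N'_def intro: Ck_bdd_subset\<close>)
      moreover have "(\<Sum>e\<in>E. \<bar>a e\<bar> * M e) \<le> M'"
      proof -
        have "(\<Sum>e\<in>E. \<bar>a e\<bar> * M e) \<le> (\<Sum>e\<in>E. \<bar>a e\<bar> * (\<Sum>e\<in>E. \<bar>M e\<bar>))"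
        proof (intro sum_mono mult_left_mono)
          show "M e \<le> (\<Sum>e\<in>E. \<bar>M e\<bar>)" if "e \<in> E" for e
            using member_le_sum[OF that _ E(1), of "\<lambda>e. \<bar>M e\<bar>"] by auto
        qed auto
        also have "\<dots> = (\<Sum>e\<in>E. \<bar>a e\<bar>) * (\<Sum>e\<in>E. \<bar>M e\<bar>)" by (simp add: sum_distrib_right)
        also have "\<dots> \<le> C * (\<Sum>e\<in>E. \<bar>M e\<bar>)"
        proof (intro mult_right_mono sum_nonneg)
          show "(\<Sum>e\<in>E. \<bar>a e\<bar>) \<le> C" using a(2) mult_left_mono[OF v C(1)] by simp
        qed auto
        finally show ?thesis by (simp add: M'_def)
      qed
      ultimately have "Ck_bdd k N' (\<lambda>y. \<Sum>e\<in>E. a e *\<^sub>R ?d e y) M'" by (rule Ck_bdd_mono)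
      then show "Ck_bdd k N' (\<lambda>y. ?d v y) M'"
      proof (rule Ck_bdd_cong[OF N'(1), rotated])
        fix y assume "y \<in> N'"
        then have "linear (frechet_derivative f (at y))" using der has_derivative_linear by blast
        then show "(\<Sum>e\<in>E. a e *\<^sub>R ?d e y) = ?d v y" by (simp add: a(1) linear_sum linear_cmul)
      qed
    qed
    then show ?case using N' by blast
  qed
qed

section \<open>Series of smooth maps, and iterates of multiplication by \<open>1 + w\<close>\<close>

lemma Ck_on_series:
  fixes f :: "nat \<Rightarrow> 'e::real_normed_vector \<Rightarrow> 'f::banach"
  assumes "open S" "\<And>n. Ck_bdd k S (f n) (M n)" "summable M" "\<And>n. 0 \<le> M n"
  shows "Ck_on k S (\<lambda>x. \<Sum>n. f n x)"
  using assms(2-)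
proof (induction k arbitrary: f M)
  case 0
  have "uniform_limit S (\<lambda>n x. \<Sum>i<n. f i x) (\<lambda>x. \<Sum>n. f n x) sequentially"
    using 0 by (intro Weierstrass_m_test) auto
  then have "continuous_on S (\<lambda>x. \<Sum>n. f n x)"
    by (rule uniform_limit_theorem[rotated]) (use 0 in \<open>auto intro!: always_eventually continuous_on_sum\<close>)
  then show ?case by simp
next
  case (Suc k)
  let ?f' = "\<lambda>n x. frechet_derivative (f n) (at x)"
  have le: "norm (f n x) \<le> M n" if "x \<in> S" for n x using Suc.prems(1)[of n] that by simp
  have le': "norm (?f' n x v) \<le> M n * norm v" if "x \<in> S" for n x v
    using Ck_bdd_norm_le[OF Ck_bdd_directional[OF assms(1) Suc.prems(1)] that] by (simp add: mult.commute)
  have der: "(f n has_derivative ?f' n x) (at x)" if "x \<in> S" for n x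
    using Suc.prems(1)[of n] that by (simp add: frechet_derivative_works[symmetric])
  have summ: "summable (\<lambda>n. ?f' n x v)" if "x \<in> S" for x v
    by (rule summable_comparison_test'[OF summable_mult2[OF Suc.prems(2)], of 0]) (use le' that in auto)
  show ?case
  proof (rule Ck_on_SucI[OF assms(1)])
    fix v
    \<comment> \<open>The induction hypothesis allows any summable majorant; here it is
      \<open>M\<close> scaled by \<open>norm v\<close>, as \<open>v\<close> need not lie in the unit
      ball.\<close>
    show "Ck_on k S (\<lambda>x. \<Sum>n. ?f' n x v)"
      by (rule Suc.IH[of _ "\<lambda>n. norm v * M n"])
        (use Suc.prems in \<open>auto intro!: Ck_bdd_directional assms(1) summable_mult\<close>)
  next
    fix x assume "x \<in> S"
    then obtain r where r: "r > 0" "ball x r \<subseteq> S" using assms(1) open_contains_ball by blast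
    have sums: "(\<lambda>n. f n x) sums (\<Sum>n. f n x)" if "x \<in> S" for x
      by (intro summable_sums summable_comparison_test'[OF Suc.prems(2), of 0]) (use le that in auto)
    have "\<exists>g. \<forall>y\<in>ball x r. (\<lambda>n. f n y) sums g y \<and> (g has_derivative (\<lambda>v. \<Sum>n. ?f' n y v)) (at y within ball x r)"
    proof (rule has_derivative_series)
      show "(f n has_derivative ?f' n y) (at y within ball x r)" if "y \<in> ball x r" for n y
        using der r that by (blast intro: has_derivative_at_withinI)
      show "\<forall>\<^sub>F n in sequentially. \<forall>y\<in>ball x r. \<forall>h.
          norm ((\<Sum>i<n. ?f' i y h) - (\<Sum>i. ?f' i y h)) \<le> e * norm h" if "e > 0" for e
      proof -
        \<comment> \<open>The tail of the numerical series dominates the tail of the differentiated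
          series, uniformly in the point and relative to the length of the direction.\<close>
        have "(\<lambda>n. suminf M - (\<Sum>i<n. M i)) \<longlonglongrightarrow> suminf M - suminf M"
          by (intro tendsto_intros summable_LIMSEQ Suc.prems)
        then have "\<forall>\<^sub>F n in sequentially. suminf M - (\<Sum>i<n. M i) < e"
          using that by (intro order_tendstoD(2)) auto
        then show ?thesis
        proof eventually_elim
          case (elim n)
          show ?case
          proof (intro ballI allI)
            fix y h assume "y \<in> ball x r"
            then have y: "y \<in> S" using r by blast
            have "norm ((\<Sum>i<n. ?f' i y h) - (\<Sum>i. ?f' i y h)) = norm (\<Sum>i. ?f' (i + n) y h)"
              using suminf_split_initial_segment[OF summ[OF y], of h n] by (simp add: norm_minus_commute)
            also have "\<dots> \<le> (\<Sum>i. M (i + n) * norm h)"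
              by (intro norm_suminf_le summable_mult2 summable_ignore_initial_segment Suc.prems le' y)
            also have "\<dots> = (suminf M - (\<Sum>i<n. M i)) * norm h"
              using suminf_split_initial_segment[OF Suc.prems(2), of n]
              by (simp add: suminf_mult2[symmetric] summable_ignore_initial_segment Suc.prems)
            also have "\<dots> \<le> e * norm h" using elim by (intro mult_right_mono) auto
            finally show "norm ((\<Sum>i<n. ?f' i y h) - (\<Sum>i. ?f' i y h)) \<le> e * norm h" .
          qed
        qed
      qed
    qed (use r sums[OF \<open>x \<in> S\<close>] in auto)
    then obtain g where gx: "\<forall>y\<in>ball x r. (\<lambda>n. f n y) sums g y \<and>
        (g has_derivative (\<lambda>v. \<Sum>n. ?f' n y v)) (at y within ball x r)" ..
    have x: "x \<in> ball x r" using r(1) by simp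
    have g: "(\<lambda>n. f n y) sums g y" if "y \<in> ball x r" for y
      using bspec[OF gx that] by (rule conjunct1)
    have "(g has_derivative (\<lambda>v. \<Sum>n. ?f' n x v)) (at x)"
      using conjunct2[OF bspec[OF gx x]] unfolding at_within_open[OF x open_ball] .
    then show "((\<lambda>x. \<Sum>n. f n x) has_derivative (\<lambda>v. \<Sum>n. ?f' n x v)) (at x)"
    proof (rule has_derivative_transform_within_open[OF _ open_ball])
      show "x \<in> ball x r" using r by simp
      show "g y = (\<Sum>n. f n y)" if "y \<in> ball x r" for y by (rule sums_unique[OF g[OF that]])
    qed
  qed
qed

text \<open>Left multiplication by \<open>1 + w\<close>, as a map because the algebra may lack a
  unit. Its iterates represent \<open>(1 + w)^n y\<close>.\<close>

definition one_plus :: "'a::real_normed_algebra \<Rightarrow> 'a \<Rightarrow> 'a" where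
  "one_plus w y = y + w * y"

lemma one_plus_Suc: "(one_plus w ^^ Suc n) y = (one_plus w ^^ n) y + w * (one_plus w ^^ n) y"
  by (simp add: one_plus_def)

lemma one_plus_add: "(one_plus w ^^ n) (x + y) = (one_plus w ^^ n) x + (one_plus w ^^ n) y"
  by (induction n) (auto simp: one_plus_def algebra_simps)

lemma one_plus_sum: "(one_plus w ^^ n) (\<Sum>i\<in>I. f i) = (\<Sum>i\<in>I. (one_plus w ^^ n) (f i))"
proof -
  have "(one_plus w ^^ n) 0 = 0" by (induction n) (auto simp: one_plus_def)
  then show ?thesis by (induction I rule: infinite_finite_induct) (auto simp: one_plus_add)
qed

text \<open>Contractivity gives a bound without growth at order 0. Each further derivative falls on
  one of \<open>n\<close> factors or on \<open>y\<close>, so the bound stays polynomial in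
  \<open>n\<close>, where repeated use of \<open>Ck_bdd_mult\<close> would give an exponential one.
  The constants \<open>C\<close> and \<open>e\<close> may depend on \<open>k\<close> but not on
  \<open>n\<close> or \<open>y\<close>.\<close>

lemma Ck_bdd_one_plus_iterate:
  fixes w :: "'e::real_normed_vector \<Rightarrow> 'a::real_normed_algebra"
  assumes "open S" "Ck_bdd k S w W" "0 \<le> W" "\<And>x y. x \<in> S \<Longrightarrow> norm (one_plus (w x) y) \<le> norm y"
  shows "\<exists>C\<ge>0. \<exists>e::nat. \<forall>n y M. 0 \<le> M \<longrightarrow> Ck_bdd k S y M
    \<longrightarrow> Ck_bdd k S (\<lambda>x. (one_plus (w x) ^^ n) (y x)) (C * real (Suc n) ^ e * M)"
  using assms(2)
proof (induction k)
  have le: "norm ((one_plus (w x) ^^ n) y) \<le> norm y" if "x \<in> S" for x n y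
    by (induction n) (auto intro: order_trans[OF assms(4)[OF that]])
  {
    case 0
    have "continuous_on S (\<lambda>x. (one_plus (w x) ^^ n) (y x))" if "continuous_on S y" for n y
      using that 0 by (induction n) (auto simp: one_plus_def intro!: continuous_intros)
    then show ?case using le
      by (intro exI[of _ "1::real"] conjI exI[of _ "0::nat"]) (auto intro: order_trans[OF le])
  next
    case (Suc k)
    obtain C e where C: "C \<ge> 0" and IH: "\<And>n y M. 0 \<le> M \<Longrightarrow> Ck_bdd k S y M
        \<Longrightarrow> Ck_bdd k S (\<lambda>x. (one_plus (w x) ^^ n) (y x)) (C * real (Suc n) ^ e * M)"
      using Suc.IH[OF Ck_bdd_lower[OF Suc.prems]] by blast
    obtain w' where w': "\<And>x. x \<in> S \<Longrightarrow> (w has_derivative w' x) (at x)"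
        "\<And>v. norm v \<le> 1 \<Longrightarrow> Ck_bdd k S (\<lambda>x. w' x v) W"
      using Ck_bdd_SucD[OF Suc.prems] by blast
    \<comment> \<open>The summands of \<open>D\<close> serve the undifferentiated iterate, the term
      with \<open>y'\<close>, and the terms with \<open>w'\<close>. The latter apply the induction
      hypothesis twice, and there are at most \<open>n\<close> of them, whence the new exponent
      \<open>2 * e + 1\<close>.\<close>
    define D where "D = 1 + C + C * 2 ^ k * W * C"
    have "Ck_bdd (Suc k) S (\<lambda>x. (one_plus (w x) ^^ n) (y x)) (D * real (Suc n) ^ (2 * e + 1) * M)"
      if M: "0 \<le> M" and y: "Ck_bdd (Suc k) S y M" for n y M
    proof -
      let ?I = "\<lambda>n y x. (one_plus (w x) ^^ n) (y x)"
      obtain y' where y': "\<And>x. x \<in> S \<Longrightarrow> (y has_derivative y' x) (at x)"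
          "\<And>v. norm v \<le> 1 \<Longrightarrow> Ck_bdd k S (\<lambda>x. y' x v) M"
        using Ck_bdd_SucD[OF y] by blast
      \<comment> \<open>The Leibniz rule for a power: the \<open>i\<close>-th summand differentiates
        the factor that has \<open>i\<close> factors to its right.\<close>
      let ?d = "\<lambda>n x v. ?I n (\<lambda>x. y' x v) x + (\<Sum>i<n. ?I (n - Suc i) (\<lambda>x. w' x v * ?I i y x) x)"
      have der: "((\<lambda>x. ?I n y x) has_derivative ?d n x) (at x)" if x: "x \<in> S" for x
      proof (induction n)
        case 0
        then show ?case using y'(1)[OF x] by simp
      next
        case (Suc n)
        have "((\<lambda>x. ?I n y x + w x * ?I n y x) has_derivative (\<lambda>v.
            ?d n x v + (w x * ?d n x v + w' x v * ?I n y x))) (at x)"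
          by (intro has_derivative_add has_derivative_mult Suc w'(1)[OF x])
        then have "((\<lambda>x. ?I (Suc n) y x) has_derivative (\<lambda>v.
            ?d n x v + (w x * ?d n x v + w' x v * ?I n y x))) (at x)"
          by (simp only: one_plus_Suc)
        moreover have "?d n x v + (w x * ?d n x v + w' x v * ?I n y x) = ?d (Suc n) x v" for v
        proof -
          have "one_plus (w x) (\<Sum>i<n. ?I (n - Suc i) (\<lambda>x. w' x v * ?I i y x) x)
              = (\<Sum>i<n. ?I (Suc n - Suc i) (\<lambda>x. w' x v * ?I i y x) x)"
          proof -
            have "one_plus (w x) (\<Sum>i<n. ?I (n - Suc i) (\<lambda>x. w' x v * ?I i y x) x)
              = (\<Sum>i<n. one_plus (w x) (?I (n - Suc i) (\<lambda>x. w' x v * ?I i y x) x))"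
              using one_plus_sum[of 1 "w x"] by simp
            also have "\<dots> = (\<Sum>i<n. ?I (Suc n - Suc i) (\<lambda>x. w' x v * ?I i y x) x)"
              by (intro sum.cong refl) (simp add: Suc_diff_Suc[symmetric])
            finally show ?thesis .
          qed
          then show ?thesis by (simp add: one_plus_def algebra_simps)
        qed
        ultimately show ?case by (simp only:)
      qed
      show ?thesis
      proof (rule Ck_bdd_SucI[OF assms(1) der])
        let ?N = "real (Suc n)"
        have N1: "1 \<le> ?N ^ j" for j by (rule one_le_power) simp
        have D: "1 + C \<le> D" using C assms(3) by (simp add: D_def)
        {
          fix x assume x: "x \<in> S"
          have "norm (?I n y x) \<le> norm (y x)" by (rule le[OF x])
          also have "\<dots> \<le> 1 * M" using y x by simp
          also have "\<dots> \<le> D * ?N ^ (2 * e + 1) * M"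
            using D C N1[of "2 * e + 1"] M by (intro mult_right_mono mult_ge1_I) auto
          finally show "norm (?I n y x) \<le> D * ?N ^ (2 * e + 1) * M" .
        }
        fix v :: 'e assume v: "norm v \<le> 1"
        have t: "Ck_bdd k S (?I (n - Suc i) (\<lambda>x. w' x v * ?I i y x)) (C * 2 ^ k * W * C * ?N ^ (2 * e) * M)"
          if "i < n" for i
        proof -
          have a: "Ck_bdd k S (?I (n - Suc i) (\<lambda>x. w' x v * ?I i y x))
              (C * real (Suc (n - Suc i)) ^ e * (2 ^ k * (W * (C * real (Suc i) ^ e * M))))"
            using C M assms(3)
            by (intro IH Ck_bdd_mult assms(1) w'(2)[OF v] Ck_bdd_lower[OF y]) auto
          have b: "C * real (Suc (n - Suc i)) ^ e * (2 ^ k * (W * (C * real (Suc i) ^ e * M)))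
              \<le> C * ?N ^ e * (2 ^ k * (W * (C * ?N ^ e * M)))"
            using C M assms(3) that by (intro mult_mono power_mono order_refl) auto
          have c: "C * ?N ^ e * (2 ^ k * (W * (C * ?N ^ e * M))) = C * 2 ^ k * W * C * ?N ^ (2 * e) * M"
            unfolding mult_2 power_add by (simp only: mult_ac)
          show ?thesis using Ck_bdd_mono[OF a b] unfolding c .
        qed
        have "Ck_bdd k S (\<lambda>x. ?d n x v) (C * ?N ^ e * M + (\<Sum>i<n. C * 2 ^ k * W * C * ?N ^ (2 * e) * M))"
          by (intro Ck_bdd_add Ck_bdd_sum assms(1) IH M y'(2) v finite_lessThan t) auto
        moreover have "C * ?N ^ e * M + (\<Sum>i<n. C * 2 ^ k * W * C * ?N ^ (2 * e) * M)
            \<le> D * ?N ^ (2 * e + 1) * M"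
        proof -
          have "C * ?N ^ e * M \<le> (1 + C) * ?N ^ (2 * e + 1) * M"
            using C M by (intro mult_mono power_increasing) auto
          moreover have "(\<Sum>i<n. C * 2 ^ k * W * C * ?N ^ (2 * e) * M) \<le> ?N * (C * 2 ^ k * W * C * ?N ^ (2 * e) * M)"
            using C M assms(3) by (simp add: mult_right_mono)
          moreover have "(1 + C) * ?N ^ (2 * e + 1) * M + ?N * (C * 2 ^ k * W * C * ?N ^ (2 * e) * M)
              = D * ?N ^ (2 * e + 1) * M"
            by (simp add: D_def algebra_simps)
          ultimately show ?thesis by linarith
        qed
        ultimately show "Ck_bdd k S (\<lambda>x. ?d n x v) (D * ?N ^ (2 * e + 1) * M)" by (rule Ck_bdd_mono)
      qed
    qed
    moreover have "D \<ge> 0" using C assms(3) by (simp add: D_def)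
    ultimately show ?case by (intro exI[of _ D] conjI exI[of _ "2 * e + 1"]) auto
  }
qed

section \<open>C*-norms and quasi-inverses\<close>

lemma scaleC_minus1: "(- 1) *\<^sub>C x = - (x::'a::cstar_algebra)"
  using scaleR_scaleC[of "-1" x] by simp

lemma scaleC_minus_left: "(- z) *\<^sub>C x = - (z *\<^sub>C (x::'a::cstar_algebra))"
  using scaleC_scaleC[of "-1" z x] by (simp add: scaleC_minus1)

lemma scaleC_minus_right: "z *\<^sub>C (- x) = - (z *\<^sub>C (x::'a::cstar_algebra))"
  using scaleC_scaleC[of z "-1" x] scaleC_minus_left[of z x] by (simp add: scaleC_minus1)

lemma scaleC_diff_right: "z *\<^sub>C (x - y) = z *\<^sub>C x - z *\<^sub>C (y::'a::cstar_algebra)"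
  using scaleC_add_right[of z x "- y"] by (simp add: scaleC_minus_right)

lemma star_scaleR: "(r *\<^sub>R x)\<^sup>\<star> = r *\<^sub>R (x::'a::cstar_algebra)\<^sup>\<star>"
  by (simp add: scaleR_scaleC star_scaleC)

lemma star_minus: "(- x)\<^sup>\<star> = - (x::'a::cstar_algebra)\<^sup>\<star>"
  using star_scaleR[of "-1" x] by simp

lemma star_diff: "(x - y)\<^sup>\<star> = x\<^sup>\<star> - (y::'a::cstar_algebra)\<^sup>\<star>"
  using star_add[of x "- y"] by (simp add: star_minus)

lemma norm_star: "norm (x\<^sup>\<star>) = norm (x::'a::cstar_algebra)"
proof -
  have *: "norm x \<le> norm (x\<^sup>\<star>)" for x :: 'a
  proof (cases "x = 0")
    case False
    have "norm x * norm x \<le> norm (x\<^sup>\<star>) * norm x"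
      using cstar_identity[of x] norm_mult_ineq[of "x\<^sup>\<star>" x] by (simp add: power2_eq_square)
    then show ?thesis using False by simp
  qed simp
  show ?thesis using *[of x] *[of "x\<^sup>\<star>"] by (simp add: star_star)
qed

lemma bounded_linear_star: "bounded_linear (star :: 'a::cstar_algebra \<Rightarrow> 'a)"
  by (rule bounded_linear_intro[where K = 1]) (auto simp: star_add star_scaleR norm_star)

lemma bounded_linear_scaleC: "bounded_linear ((*\<^sub>C) z :: 'a::cstar_algebra \<Rightarrow> 'a)"
  by (rule bounded_linear_intro[where K = "cmod z"])
    (auto simp: scaleC_add_right norm_scaleC scaleR_scaleC scaleC_scaleC mult.commute)

lemma cstar_norm_on_norm: "cstar_norm_on B norm"
  by (auto simp: cstar_norm_on_def norm_triangle_ineq norm_scaleC norm_mult_ineq norm_star cstar_identity)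

lemma star_subalgebra_UNIV: "star_subalgebra UNIV"
  by (simp add: star_subalgebra_def)

text \<open>With a unit, \<open>1 + d\<close> would be the inverse of \<open>1 - b\<close>. Here
  \<open>d\<close> is the fixed point of a contraction, which gives the first equation;
  \<open>b + d * b\<close> is a fixed point as well, so uniqueness gives the second.\<close>

lemma quasi_inverse_exists:
  fixes b :: "'a::{real_normed_algebra, banach}"
  assumes "norm b < 1"
  obtains d where "d = b + b * d" "d = b + d * b"
proof -
  have "\<exists>!d. b + b * d = d"
  proof (rule banach_fix_type[of "norm b"])
    show "\<forall>x y. dist (b + b * x) (b + b * y) \<le> norm b * dist x y"
      by (simp add: dist_norm right_diff_distrib[symmetric] norm_mult_ineq)
  qed (use assms in auto)
  then obtain d where d: "b + b * d = d" and uniq: "\<And>e. b + b * e = e \<Longrightarrow> e = d" by blast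
  have "b + b * (b + d * b) = b + (b + b * d) * b" by (simp add: algebra_simps)
  also have "\<dots> = b + d * b" by (simp only: d)
  finally have "b + d * b = d" by (rule uniq)
  then show ?thesis using that[of d] d by simp
qed

section \<open>The upper bound for an arbitrary C*-norm\<close>

locale cstar_normed_subalgebra =
  fixes B :: "'a::cstar_algebra set" and p :: "'a \<Rightarrow> real"
  assumes subalgebra: "star_subalgebra B" and cnorm: "cstar_norm_on B p"
begin

lemma closed_ops [simp]:
  assumes "x \<in> B" "y \<in> B"
  shows "x + y \<in> B" "x - y \<in> B" "- x \<in> B" "x * y \<in> B" "x\<^sup>\<star> \<in> B" "z *\<^sub>C x \<in> B" "r *\<^sub>R x \<in> B"
proof -
  have s: "z *\<^sub>C x \<in> B" if "x \<in> B" for z x using subalgebra that by (simp add: star_subalgebra_def)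
  have m: "- x \<in> B" if "x \<in> B" for x using s[of x "-1"] that by (simp add: scaleC_minus1)
  show "x + y \<in> B" "x * y \<in> B" "x\<^sup>\<star> \<in> B" "z *\<^sub>C x \<in> B" "- x \<in> B" "r *\<^sub>R x \<in> B"
    using subalgebra assms m s by (auto simp: star_subalgebra_def scaleR_scaleC)
  show "x - y \<in> B" using subalgebra assms(1) m[OF assms(2)]
    by (auto simp: star_subalgebra_def simp del: add_uminus_conv_diff simp add: diff_conv_add_uminus)
qed

lemma p_rules:
  assumes "x \<in> B" "y \<in> B"
  shows p_nonneg: "0 \<le> p x" and p_eq_0: "p x = 0 \<longleftrightarrow> x = 0"
    and p_triangle: "p (x + y) \<le> p x + p y" and p_scaleC: "p (z *\<^sub>C x) = cmod z * p x"
    and p_scaleR: "p (r *\<^sub>R x) = \<bar>r\<bar> * p x"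
    and p_mult: "p (x * y) \<le> p x * p y" and p_star_mult: "p (x\<^sup>\<star> * x) = (p x)\<^sup>2"
  using assms cnorm by (simp_all add: cstar_norm_on_def scaleR_scaleC)

lemma p_triangle_diff:
  assumes "x \<in> B" "y \<in> B"
  shows "p (x - y) \<le> p x + p y"
  using p_triangle[of x "- y"] p_scaleR[of y y "-1"] assms by simp

text \<open>The elements \<open>(1 \<plusminus> ic)\<^sup>2 y\<close> have the same norm as \<open>(1 + c\<^sup>2) y\<close>, and their difference
  is \<open>4icy\<close>.\<close>

lemma p_one_plus_square:
  assumes "c \<in> B" "c\<^sup>\<star> = c" "y \<in> B"
  shows "2 * p (c * y) \<le> p (y + c * (c * y))"
proof -
  define Z where "Z = y + c * (c * y)"
  define A where "A z = y + z *\<^sub>C (c * y) - c * (c * y)" for z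
  have B: "Z \<in> B" "A z \<in> B" "c * y \<in> B" for z using assms by (auto simp: Z_def A_def)
  have eq: "(A z)\<^sup>\<star> * A z = Z\<^sup>\<star> * Z" if "z = 2 * \<i> \<or> z = - (2 * \<i>)" for z
  proof -
    have four: "4 *\<^sub>C x = 2 *\<^sub>R x + 2 *\<^sub>R x" for x :: 'a
      using scaleR_scaleC[of 4 x] scaleR_add_left[of 2 2 x] by simp
    show ?thesis using that assms(2)
      by (auto simp: A_def Z_def star_add star_diff star_mult star_scaleC star_minus algebra_simps mult_scaleC_left
          mult_scaleC_right scaleC_scaleC scaleC_minus_left scaleC_minus_right scaleC_diff_right scaleC_add_right
          four scaleR_2)
  qed
  have "p (A z) = p Z" if "z = 2 * \<i> \<or> z = - (2 * \<i>)" for z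
  proof -
    have "(p (A z))\<^sup>2 = (p Z)\<^sup>2"
      using eq[OF that] p_star_mult[OF B(2)[of z] B(1)] p_star_mult[OF B(1) B(1)] by simp
    then show ?thesis using p_nonneg[OF B(1) B(1)] p_nonneg[OF B(2) B(1)] by simp
  qed
  then have "p (A (2 * \<i>) - A (- (2 * \<i>))) \<le> p Z + p Z"
    using p_triangle_diff[OF B(2) B(2), of "2 * \<i>" "- (2 * \<i>)"] by simp
  moreover have "A (2 * \<i>) - A (- (2 * \<i>)) = (4 * \<i>) *\<^sub>C (c * y)"
    using scaleC_add_left[of "2 * \<i>" "2 * \<i>" "c * y"] by (simp add: A_def scaleC_minus_left)
  ultimately show ?thesis using p_scaleC[OF B(3) B(3), of "4 * \<i>"] by (simp add: Z_def norm_mult)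
qed

text \<open>The factorization \<open>1 - c^4 = (1 + c^2) (1 - c^2)\<close>: the hypothesis at
  \<open>c * y\<close> handles the second factor, and the first contributes the 2 through
  \<open>p_one_plus_square\<close>.\<close>

lemma p_lower_bound_double:
  assumes "c \<in> B" "c\<^sup>\<star> = c"
    and "\<And>y. y \<in> B \<Longrightarrow> \<delta> * p (c * y) \<le> p (y - c * (c * y))" and "y \<in> B"
  shows "2 * \<delta> * p ((c * c) * y) \<le> p (y - (c * c) * ((c * c) * y))"
proof -
  let ?z = "y - c * (c * y)"
  have "2 * (\<delta> * p (c * (c * y))) \<le> 2 * p (c * y - c * (c * (c * y)))"
    using assms by (intro mult_left_mono) auto
  also have "\<dots> = 2 * p (c * ?z)" by (simp add: algebra_simps)
  also have "\<dots> \<le> p (?z + c * (c * ?z))" using assms by (intro p_one_plus_square) auto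
  also have "?z + c * (c * ?z) = y - (c * c) * ((c * c) * y)" by (simp add: algebra_simps)
  finally show ?thesis by (simp add: mult.assoc)
qed

text \<open>Passing from \<open>c\<close> to \<open>c * c\<close> doubles \<delta> while the
  C*-identity keeps \<open>p c = 1\<close>. Testing with \<open>y = c\<close> caps every such
  constant at \<open>p c + p (c^3) \<le> 2\<close>.\<close>

lemma p_lower_bound_le:
  assumes "c \<in> B" "c\<^sup>\<star> = c" "p c = 1"
    and "\<And>y. y \<in> B \<Longrightarrow> \<delta> * p (c * y) \<le> p (y - c * (c * y))"
  shows "2 ^ m * \<delta> \<le> 2"
  using assms
proof (induction m arbitrary: c \<delta>)
  case 0
  have cc: "p (c * c) = 1" using p_star_mult[OF 0(1) 0(1)] 0 by simp
  have "\<delta> \<le> p (c - c * (c * c))" using 0(4)[OF 0(1)] cc by simp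
  also have "\<dots> \<le> p c + p (c * (c * c))" using 0 by (intro p_triangle_diff) auto
  also have "\<dots> \<le> p c + p c * p (c * c)" using 0 by (intro add_left_mono p_mult) auto
  finally show ?case using 0 cc by simp
next
  case (Suc m)
  have "2 ^ m * (2 * \<delta>) \<le> 2"
  proof (rule Suc.IH[of "c * c"])
    show "p (c * c) = 1" using p_star_mult[OF Suc.prems(1,1)] Suc.prems by simp
    show "2 * \<delta> * p (c * c * y) \<le> p (y - c * c * (c * c * y))" if "y \<in> B" for y
      by (rule p_lower_bound_double[OF Suc.prems(1,2,4) that])
  qed (use Suc.prems in \<open>simp_all add: star_mult\<close>)
  then show ?case by simp
qed

text \<open>A violation would make some \<open>c\<close> with \<open>p c = 1\<close> small in
  \<open>norm\<close>, so that \<open>1 - c^2\<close> is invertible through \<open>B\<close>. This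
  gives a positive lower bound constant, which repeated doubling drives beyond 2.\<close>

lemma p_le_norm:
  assumes qi: "\<And>b d. b \<in> B \<Longrightarrow> norm b < 1 \<Longrightarrow> d = b + b * d \<Longrightarrow> d = b + d * b \<Longrightarrow> d \<in> B"
    and "a \<in> B"
  shows "p a \<le> norm a"
proof (rule ccontr)
  assume "\<not> p a \<le> norm a"
  then have less: "norm a < p a" by simp
  then have pa: "p a > 0" by (rule le_less_trans[OF norm_ge_zero])
  \<comment> \<open>Normalized so that \<open>p c = 1\<close> and
    \<open>norm c = (norm a / p a)^2 < 1\<close>.\<close>
  define c where "c = (inverse ((p a)\<^sup>2)) *\<^sub>R (a\<^sup>\<star> * a)"
  have c: "c \<in> B" "c\<^sup>\<star> = c" using assms(2) by (auto simp: c_def star_scaleR star_mult star_star)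
  have "p c = 1" using assms(2) pa by (simp add: c_def p_scaleR p_star_mult)
  have "norm c = (norm a / p a)\<^sup>2"
    by (simp add: c_def cstar_identity divide_inverse power_mult_distrib power_inverse mult.commute)
  also have "\<dots> < 1" using less pa by (simp add: power_less_one_iff)
  finally have "norm c < 1" .
  then have "norm (c * c) < 1"
    using norm_mult_ineq[of c c] mult_strict_mono[of "norm c" 1 "norm c" 1] by simp
  then obtain d where d: "d = c * c + (c * c) * d" "d = c * c + d * (c * c)"
    by (rule quasi_inverse_exists)
  then have "d \<in> B" using qi[of "c * c" d] \<open>norm (c * c) < 1\<close> c by simp
  then have pd: "0 \<le> p d" by (rule p_nonneg) (rule assms(2))
  \<comment> \<open>\<open>1 + d\<close> inverts \<open>1 - c^2\<close>, so \<open>y\<close> is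
    recovered from \<open>y - c^2 y\<close> at the cost of a factor \<open>1 + p d\<close>.\<close>
  have "inverse (1 + p d) * p (c * y) \<le> p (y - c * (c * y))" if y: "y \<in> B" for y
  proof -
    let ?z = "y - c * (c * y)"
    have z: "?z \<in> B" using c y by simp
    have "d * y = c * c * y + d * (c * c) * y" using arg_cong[OF d(2), of "\<lambda>x. x * y"] by (simp add: distrib_right)
    then have "y = ?z + d * ?z" by (simp add: algebra_simps)
    then have "p y = p (?z + d * ?z)" by (rule arg_cong)
    also have "\<dots> \<le> p ?z + p (d * ?z)" by (intro p_triangle closed_ops z \<open>d \<in> B\<close>)
    also have "\<dots> \<le> p ?z + p d * p ?z" using p_mult[of d ?z] z \<open>d \<in> B\<close> by simp
    finally have "p y \<le> (1 + p d) * p ?z" by (simp add: algebra_simps)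
    moreover have "p (c * y) \<le> p y" using p_mult[of c y] c y \<open>p c = 1\<close> by simp
    ultimately show ?thesis using pd by (simp add: field_simps)
  qed
  then have "2 ^ m * inverse (1 + p d) \<le> 2" for m :: nat
    by (rule p_lower_bound_le[OF c \<open>p c = 1\<close>])
  then have "2 ^ m \<le> 2 * (1 + p d)" for m :: nat using pd by (simp add: field_simps)
  moreover obtain m :: nat where "2 * (1 + p d) < 2 ^ m" using real_arch_pow[of 2] by auto
  ultimately show False by (meson not_less)
qed

end

text \<open>The pulled-back norm is itself a C*-norm on the whole algebra, injectivity giving
  definiteness, so the upper bound applies. Continuity of automorphisms is thus a consequence, and
  they may be moved through infinite series.\<close>

lemma star_automorphism_contraction:
  assumes "star_automorphism f"
  shows "norm (f a) \<le> norm a"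
proof -
  have f0: "f 0 = 0" using assms unfolding star_automorphism_def by (metis add_cancel_right_right)
  then have "f x = 0 \<longleftrightarrow> x = 0" for x
    using assms unfolding star_automorphism_def by (metis bij_pointE)
  then have "cstar_norm_on UNIV (\<lambda>x. norm (f x))"
    using assms
    by (simp add: cstar_norm_on_def star_automorphism_def norm_scaleC norm_star cstar_identity
        norm_triangle_ineq norm_mult_ineq)
  then interpret cstar_normed_subalgebra UNIV "\<lambda>x. norm (f x)"
    by unfold_locales (rule star_subalgebra_UNIV)
  show ?thesis by (rule p_le_norm) auto
qed

section \<open>Fourier coefficients\<close>

definition periodic_Ck :: "nat \<Rightarrow> (real \<Rightarrow> real) \<Rightarrow> bool" where
  "periodic_Ck k f \<longleftrightarrow> Ck_on k UNIV f \<and> (\<forall>t. f (t + 2 * pi) = f t)"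

lemma periodic_Ck_const [simp]: "periodic_Ck k (\<lambda>t. c)"
  by (simp add: periodic_Ck_def Ck_on_const)

lemma periodic_Ck_cos [simp]: "periodic_Ck k cos"
  using Ck_on_sin_cos[OF open_UNIV Ck_on_bounded_linear[OF open_UNIV bounded_linear_ident]]
  by (simp add: periodic_Ck_def)

lemma periodic_Ck_continuous: "periodic_Ck k f \<Longrightarrow> continuous_on S f"
  using Ck_on_continuous[of k UNIV f] by (auto simp: periodic_Ck_def intro: continuous_on_subset)

lemma periodic_Ck_ops:
  assumes "periodic_Ck k f" "periodic_Ck k g"
  shows periodic_Ck_add: "periodic_Ck k (\<lambda>t. f t + g t)"
    and periodic_Ck_diff: "periodic_Ck k (\<lambda>t. f t - g t)"
    and periodic_Ck_mult: "periodic_Ck k (\<lambda>t. f t * g t)"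
  using assms by (auto simp: periodic_Ck_def intro!: Ck_on_add Ck_on_diff Ck_on_mult)

lemma periodic_Ck_inverse:
  "periodic_Ck k f \<Longrightarrow> (\<And>t. f t \<noteq> 0) \<Longrightarrow> periodic_Ck k (\<lambda>t. inverse (f t))"
  by (auto simp: periodic_Ck_def intro!: Ck_on_inverse)

lemma periodic_Ck_smooth_step:
  "a < b \<Longrightarrow> periodic_Ck k f \<Longrightarrow> periodic_Ck k (\<lambda>t. smooth_step a b (f t))"
  by (auto simp: periodic_Ck_def intro!: Ck_on_smooth_step)

lemma periodic_Ck_power: "periodic_Ck k f \<Longrightarrow> periodic_Ck k (\<lambda>t. f t ^ n)"
  by (induction n) (auto intro: periodic_Ck_mult)

lemma periodic_bounded:
  assumes "continuous_on UNIV f" "\<And>t. f (t + 2 * pi) = (f t :: real)"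
  shows "\<exists>M\<ge>0. \<forall>t. \<bar>f t\<bar> \<le> M"
proof -
  interpret periodic_fun_simple f "2 * pi" by unfold_locales (rule assms(2))
  have "compact (f ` {-pi..pi})"
    by (intro compact_continuous_image continuous_on_subset[OF assms(1)]) auto
  then obtain M where M: "\<And>t. t \<in> {-pi..pi} \<Longrightarrow> \<bar>f t\<bar> \<le> M"
    by (fastforce dest: compact_imp_bounded simp: bounded_iff)
  have "\<bar>f t\<bar> \<le> M" for t
  proof -
    let ?k = "\<lfloor>(t + pi) / (2 * pi)\<rfloor>"
    have "of_int ?k * (2 * pi) \<le> t + pi" "t + pi < (of_int ?k + 1) * (2 * pi)"
      by (rule floor_divide_lower floor_divide_upper; simp)+
    then have "of_int ?k * (2 * pi) \<le> t + pi" "t + pi < of_int ?k * (2 * pi) + 2 * pi"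
      by (simp_all only: distrib_right mult_1_left)
    then have "t - of_int ?k * (2 * pi) \<in> {-pi..pi}" by auto
    from M[OF this] show ?thesis by (simp only: minus_of_int)
  qed
  moreover have "0 \<le> M" using M[of 0] by (simp add: abs_ge_zero[THEN order_trans])
  ultimately show ?thesis by blast
qed

lemma periodic_Ck_SucD:
  assumes "periodic_Ck (Suc k) f"
  shows "\<exists>f'. (\<forall>t. (f has_real_derivative f' t) (at t)) \<and> periodic_Ck k f'"
proof -
  let ?f' = "\<lambda>t. frechet_derivative f (at t) 1"
  have d: "(f has_real_derivative ?f' t) (at t)" for t
  proof -
    have der: "(f has_derivative frechet_derivative f (at t)) (at t)"
      using assms by (simp add: periodic_Ck_def frechet_derivative_works[symmetric])
    have "v * ?f' t = frechet_derivative f (at t) v" for v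
      using linear_cmul[OF has_derivative_linear[OF der], of v 1]
      by (simp only: real_scaleR_def mult_1_right)
    with der show ?thesis by (rule has_derivative_imp_has_field_derivative)
  qed
  have "?f' (t + 2 * pi) = ?f' t" for t
  proof (rule DERIV_unique)
    have "((\<lambda>t. f (t + 2 * pi)) has_real_derivative ?f' (t + 2 * pi)) (at t)"
      by (rule iffD1[OF DERIV_shift d])
    then show "(f has_real_derivative ?f' (t + 2 * pi)) (at t)" using assms by (simp add: periodic_Ck_def)
  qed (rule d)
  then show ?thesis using d assms by (intro exI[of _ ?f']) (auto simp: periodic_Ck_def)
qed

lemma periodic_Ck_bounded:
  "periodic_Ck k f \<Longrightarrow> \<exists>M\<ge>0. Ck_bdd k UNIV f M"
proof (induction k arbitrary: f)
  case 0
  then show ?case using periodic_bounded[of f] by (auto simp: periodic_Ck_def)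
next
  case (Suc k)
  obtain f' where f': "\<And>t. (f has_real_derivative f' t) (at t)" "periodic_Ck k f'"
    using periodic_Ck_SucD[OF Suc.prems] by blast
  obtain M' where M': "0 \<le> M'" "Ck_bdd k UNIV f' M'" using Suc.IH[OF f'(2)] by blast
  obtain M where M: "0 \<le> M" "\<And>t. \<bar>f t\<bar> \<le> M"
    using periodic_bounded[of f] Suc.prems Ck_on_continuous[of "Suc k" UNIV f] by (auto simp: periodic_Ck_def)
  have "Ck_bdd (Suc k) UNIV f (max M M')"
  proof (rule Ck_bdd_SucI[OF open_UNIV])
    show "(f has_derivative (\<lambda>v. v * f' t)) (at t)" for t
      using f'(1)[of t] by (simp add: has_field_derivative_def mult_commute_abs)
    show "norm (f t) \<le> max M M'" for t using M(2)[of t] by simp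
    fix v :: real assume "norm v \<le> 1"
    then have "\<bar>v\<bar> * M' \<le> max M M'" using mult_right_mono[of "\<bar>v\<bar>" 1 M'] M'(1) by simp
    then show "Ck_bdd k UNIV (\<lambda>t. v * f' t) (max M M')"
      using Ck_bdd_mono[OF Ck_bdd_scaleR[OF open_UNIV M'(2), of v]] by simp
  qed
  then show ?case using M(1) by (intro exI[of _ "max M M'"]) simp
qed

text \<open>Each integration by parts gains a factor \<open>n\<close>; the boundary terms cancel by
  periodicity. Sine and cosine integrals are treated together because this step exchanges
  them.\<close>

lemma fourier_decay:
  assumes "periodic_Ck k f" "Ck_bdd k UNIV f M"
  shows "real n ^ k * \<bar>integral {-pi..pi} (\<lambda>t. f t * cos (n * t))\<bar> \<le> 2 * pi * M
    \<and> real n ^ k * \<bar>integral {-pi..pi} (\<lambda>t. f t * sin (n * t))\<bar> \<le> 2 * pi * M"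
  using assms
proof (induction k arbitrary: f)
  case 0
  have c: "continuous_on S f" for S using 0 by (auto simp: periodic_Ck_def intro: continuous_on_subset)
  have M: "\<bar>f t\<bar> \<le> M" for t using 0(2) by simp
  have b: "\<bar>f t * s\<bar> \<le> M" if "\<bar>s\<bar> \<le> 1" for t s
    using mult_mono[OF M[of t] that] M[of t] by (simp add: abs_mult)
  have "norm (integral {-pi..pi} (\<lambda>t. f t * cos (n * t))) \<le> M * (pi - - pi)"
    by (intro integral_bound continuous_intros c) (use b in auto)
  moreover have "norm (integral {-pi..pi} (\<lambda>t. f t * sin (n * t))) \<le> M * (pi - - pi)"
    by (intro integral_bound continuous_intros c) (use b in auto)
  ultimately show ?case by (simp add: mult.commute)
next
  case (Suc k)
  obtain f' where f': "\<And>t. (f has_real_derivative f' t) (at t)" "periodic_Ck k f'"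
    using periodic_Ck_SucD[OF Suc.prems(1)] by blast
  have bdd: "Ck_bdd k UNIV f' M"
  proof -
    have "frechet_derivative f (at t) 1 = f' t" for t
      using frechet_derivative_at[OF f'(1)[unfolded has_field_derivative_def], of t] by (metis mult.right_neutral)
    then show ?thesis using Suc.prems(2) by (auto dest: spec[of _ "1::real"])
  qed
  have c: "continuous_on S f" "continuous_on S f'" for S
    using f' Ck_on_continuous[of k UNIV f']
    by (auto simp: periodic_Ck_def intro: continuous_on_subset DERIV_continuous_on DERIV_subset)
  have per: "f (- pi) = f pi" using Suc.prems(1) by (auto simp: periodic_Ck_def dest: spec[of _ "- pi"])
  have i: "(\<lambda>t. g t * h (n * t)) integrable_on {-pi..pi}"
    if "continuous_on {-pi..pi} g" "continuous_on UNIV h" for g h :: "real \<Rightarrow> real"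
    by (intro integrable_continuous_interval continuous_intros that continuous_on_compose2[OF that(2)]) auto
  have "((\<lambda>t. f' t * cos (n * t) + f t * (- sin (n * t) * n)) has_integral
      f pi * cos (n * pi) - f (- pi) * cos (n * (- pi))) {-pi..pi}"
    by (intro fundamental_theorem_of_calculus)
      (auto simp: has_real_derivative_iff_has_vector_derivative[symmetric] intro!: derivative_eq_intros DERIV_subset[OF f'(1)])
  then have "integral {-pi..pi} (\<lambda>t. f' t * cos (n * t) - n * (f t * sin (n * t))) = 0"
    by (auto dest!: integral_unique simp: per algebra_simps)
  then have C: "integral {-pi..pi} (\<lambda>t. f' t * cos (n * t)) = n * integral {-pi..pi} (\<lambda>t. f t * sin (n * t))"
    by (subst (asm) integral_diff) (auto intro!: i c continuous_intros integrable_on_mult_right)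
  have "((\<lambda>t. f' t * sin (n * t) + f t * (cos (n * t) * n)) has_integral
      f pi * sin (n * pi) - f (- pi) * sin (n * (- pi))) {-pi..pi}"
    by (intro fundamental_theorem_of_calculus)
      (auto simp: has_real_derivative_iff_has_vector_derivative[symmetric] intro!: derivative_eq_intros DERIV_subset[OF f'(1)])
  then have "integral {-pi..pi} (\<lambda>t. f' t * sin (n * t) + n * (f t * cos (n * t))) = 0"
    by (auto dest!: integral_unique simp: per algebra_simps)
  then have S: "integral {-pi..pi} (\<lambda>t. f' t * sin (n * t)) = - n * integral {-pi..pi} (\<lambda>t. f t * cos (n * t))"
    by (subst (asm) integral_add) (auto intro!: i c continuous_intros integrable_on_mult_right)
  show ?case using Suc.IH[OF f'(2) bdd] unfolding C S by (simp add: abs_mult mult_ac)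
qed

text \<open>The cosine coefficient. At \<open>n = 0\<close> it is twice the mean of
  \<open>f\<close>, which is why \<open>calc\<close> halves that term.\<close>

definition fourier_coeff :: "(real \<Rightarrow> real) \<Rightarrow> nat \<Rightarrow> real" where
  "fourier_coeff f n = integral {-pi..pi} (\<lambda>t. f t * cos (n * t)) / pi"

text \<open>The denominator uses \<open>n + 1\<close> so that \<open>n = 0\<close> is covered. Since
  \<open>n + 1 \<le> 2 n\<close> for \<open>n \<ge> 1\<close>, this costs the factor
  \<open>2 ^ k\<close>.\<close>

lemma fourier_coeff_decay:
  assumes "periodic_Ck k f" "Ck_bdd k UNIV f M"
  shows "\<bar>fourier_coeff f n\<bar> \<le> 2 ^ Suc k * M / real (Suc n) ^ k"
proof (cases n)
  case 0
  have "periodic_Ck 0 f" using assms(1) Ck_on_continuous by (auto simp: periodic_Ck_def)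
  moreover have "Ck_bdd 0 UNIV f M"
    using Ck_bdd_norm_le[OF assms(2)] calculation by (auto simp: periodic_Ck_def)
  ultimately have "\<bar>integral {-pi..pi} f\<bar> \<le> 2 * pi * M" using fourier_decay[of 0 f M 0] by simp
  then have "\<bar>fourier_coeff f n\<bar> \<le> 2 * M"
    by (simp add: fourier_coeff_def 0 abs_divide field_simps)
  also have "\<dots> \<le> 2 ^ k * (2 * M)"
    using Ck_bdd_norm_le[OF assms(2), of 0] mult_right_mono[OF one_le_power[of "2::real" k], of "2 * M"]
    by (simp add: order_trans[OF abs_ge_zero])
  finally show ?thesis by (simp add: 0 mult_ac)
next
  case (Suc m)
  have "real (Suc n) ^ k * \<bar>fourier_coeff f n\<bar> \<le> (2 * real n) ^ k * \<bar>fourier_coeff f n\<bar>"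
    using Suc by (intro mult_right_mono power_mono) auto
  also have "\<dots> = 2 ^ k * (real n ^ k * \<bar>integral {-pi..pi} (\<lambda>t. f t * cos (n * t))\<bar>) / pi"
    by (simp add: fourier_coeff_def abs_divide power_mult_distrib)
  also have "\<dots> \<le> 2 ^ k * (2 * pi * M) / pi"
    using fourier_decay[OF assms] by (intro divide_right_mono mult_left_mono) auto
  finally show ?thesis by (simp add: field_simps)
qed

lemma fourier_coeff_diff:
  assumes "periodic_Ck k f" "periodic_Ck k g"
  shows "fourier_coeff (\<lambda>t. f t - g t) n = fourier_coeff f n - fourier_coeff g n"
proof -
  have i: "(\<lambda>t. f t * cos (n * t)) integrable_on {-pi..pi}" if "periodic_Ck k f" for f
    by (intro integrable_continuous_interval continuous_intros periodic_Ck_continuous[OF that])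
  show ?thesis
    by (simp add: fourier_coeff_def left_diff_distrib integral_diff[OF i[OF assms(1)] i[OF assms(2)]] diff_divide_distrib)
qed

text \<open>By the addition formulas, multiplication by cosine averages the two neighbouring
  coefficients; at index 0 the neighbours of index 1 and -1 coincide.\<close>

lemma fourier_coeff_cos_mult:
  assumes "periodic_Ck k f"
  shows "fourier_coeff (\<lambda>t. cos t * f t) 0 = fourier_coeff f 1"
    and "fourier_coeff (\<lambda>t. cos t * f t) (Suc n) = (fourier_coeff f (Suc (Suc n)) + fourier_coeff f n) / 2"
proof -
  show "fourier_coeff (\<lambda>t. cos t * f t) 0 = fourier_coeff f 1" by (simp add: fourier_coeff_def mult.commute)
  have i: "(\<lambda>t. f t * cos (n * t) / 2) integrable_on {-pi..pi}" for n :: nat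
    by (intro integrable_continuous_interval continuous_intros periodic_Ck_continuous[OF assms]) simp
  have "cos t * f t * cos (real (Suc n) * t) = f t * cos (real (Suc (Suc n)) * t) / 2 + f t * cos (n * t) / 2" for t :: real
  proof -
    have "real (Suc (Suc n)) * t = real (Suc n) * t + t" "real n * t = real (Suc n) * t - t" by (simp_all add: algebra_simps)
    then have "cos (real (Suc (Suc n)) * t) + cos (n * t) = 2 * (cos (real (Suc n) * t) * cos t)"
      by (simp only: cos_add cos_diff)
    then have "f t * (cos (real (Suc (Suc n)) * t) + cos (n * t)) / 2 = f t * (2 * (cos (real (Suc n) * t) * cos t)) / 2"
      by (simp only:)
    then show ?thesis by (simp only: distrib_left add_divide_distrib) (simp add: mult_ac)
  qed
  then show "fourier_coeff (\<lambda>t. cos t * f t) (Suc n) = (fourier_coeff f (Suc (Suc n)) + fourier_coeff f n) / 2"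
    unfolding fourier_coeff_def by (simp only: integral_add[OF i i] integral_divide) (simp add: add_divide_distrib)
qed

lemma fourier_coeff_1:
  shows "fourier_coeff (\<lambda>t. 1) 0 = 2" and "fourier_coeff (\<lambda>t. 1) (Suc n) = 0"
proof -
  show "fourier_coeff (\<lambda>t. 1) 0 = 2" by (simp add: fourier_coeff_def)
  have "((\<lambda>t. cos (real (Suc n) * t)) has_integral
      sin (real (Suc n) * pi) / real (Suc n) - sin (real (Suc n) * - pi) / real (Suc n)) {-pi..pi}"
    by (intro fundamental_theorem_of_calculus)
      (auto simp: has_real_derivative_iff_has_vector_derivative[symmetric] simp del: of_nat_Suc
        intro!: derivative_eq_intros)
  then show "fourier_coeff (\<lambda>t. 1) (Suc n) = 0"
    by (auto dest!: integral_unique simp: fourier_coeff_def simp del: of_nat_Suc)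
qed

section \<open>Functional calculus for unitaries\<close>

text \<open>States that \<open>1 + w\<close> is unitary, with the products multiplied out so that no
  unit occurs.\<close>

definition quasi_unitary :: "'a::cstar_algebra \<Rightarrow> bool" where
  "quasi_unitary w \<longleftrightarrow> w + w\<^sup>\<star> + w\<^sup>\<star> * w = 0 \<and> w + w\<^sup>\<star> + w * w\<^sup>\<star> = 0"

lemma quasi_unitary_star: "quasi_unitary w \<Longrightarrow> quasi_unitary (w\<^sup>\<star>)"
  by (simp add: quasi_unitary_def star_star add.commute)

lemma norm_one_plus:
  assumes "quasi_unitary w"
  shows "norm (one_plus w y) = norm y"
proof -
  have "(one_plus w y)\<^sup>\<star> * one_plus w y = y\<^sup>\<star> * y + y\<^sup>\<star> * ((w + w\<^sup>\<star> + w\<^sup>\<star> * w) * y)"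
    by (simp add: one_plus_def star_add star_mult algebra_simps)
  also have "\<dots> = y\<^sup>\<star> * y" using assms by (simp add: quasi_unitary_def)
  finally have "(norm (one_plus w y))\<^sup>2 = (norm y)\<^sup>2" by (metis cstar_identity)
  then show ?thesis by simp
qed

lemma one_plus_star_cancel:
  assumes "quasi_unitary w"
  shows "one_plus w (one_plus (w\<^sup>\<star>) y) = y"
proof -
  have "one_plus w (one_plus (w\<^sup>\<star>) y) = y + (w + w\<^sup>\<star> + w * w\<^sup>\<star>) * y"
    by (simp add: one_plus_def algebra_simps)
  then show ?thesis using assms by (simp add: quasi_unitary_def)
qed

lemma norm_one_plus_iterate: "quasi_unitary w \<Longrightarrow> norm ((one_plus w ^^ n) y) = norm y"
  by (induction n) (auto simp: norm_one_plus)

text \<open>With \<open>u = 1 + w = exp (i\<theta>)\<close>, this is \<open>y \<mapsto> cos (n\<theta>) y\<close>.\<close>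

definition cos_op :: "'a::cstar_algebra \<Rightarrow> nat \<Rightarrow> 'a \<Rightarrow> 'a" where
  "cos_op w n y = (1/2) *\<^sub>R ((one_plus w ^^ n) y + (one_plus (w\<^sup>\<star>) ^^ n) y)"

text \<open>This is \<open>1 - Re u\<close> for \<open>u = 1 + w\<close>. Unlike
  \<open>Re u\<close>, it lies in the algebra even without a unit.\<close>

definition one_minus_cos :: "'a::cstar_algebra \<Rightarrow> 'a" where
  "one_minus_cos w = (- 1/2) *\<^sub>R (w + w\<^sup>\<star>)"

lemma one_minus_cos_star: "(one_minus_cos w)\<^sup>\<star> = one_minus_cos w"
  by (simp add: one_minus_cos_def star_scaleR star_minus star_add star_star add.commute)

lemma cos_op_0 [simp]: "cos_op w 0 y = y"
  by (simp add: cos_op_def flip: scaleR_2)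

lemma norm_cos_op_le:
  assumes "quasi_unitary w"
  shows "norm (cos_op w n y) \<le> norm y"
  using norm_triangle_ineq[of "(one_plus w ^^ n) y" "(one_plus (w\<^sup>\<star>) ^^ n) y"]
  by (simp add: cos_op_def norm_one_plus_iterate assms quasi_unitary_star)

lemma one_minus_cos_eq: "y - one_minus_cos w * y = (1/2) *\<^sub>R (one_plus w y + one_plus (w\<^sup>\<star>) y)"
proof -
  have "(1/2) *\<^sub>R (y + y) = y" by (simp flip: scaleR_2)
  then show ?thesis by (simp add: one_minus_cos_def one_plus_def algebra_simps)
qed

text \<open>The operator form of \<open>2 cos \<theta> cos (n\<theta>) = cos ((n+1)\<theta>) + cos
  ((n-1)\<theta>)\<close>, using that \<open>1 + w\<close> and its adjoint are mutually
  inverse.\<close>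

lemma cos_op_step:
  assumes "quasi_unitary w"
  shows "cos_op w 0 y - one_minus_cos w * cos_op w 0 y = cos_op w 1 y"
    and "cos_op w (Suc n) y - one_minus_cos w * cos_op w (Suc n) y
      = (1/2) *\<^sub>R (cos_op w (Suc (Suc n)) y + cos_op w n y)"
proof -
  show "cos_op w 0 y - one_minus_cos w * cos_op w 0 y = cos_op w 1 y"
    unfolding cos_op_0 one_minus_cos_eq by (simp add: cos_op_def)
  let ?U = "one_plus w" and ?V = "one_plus (w\<^sup>\<star>)"
  have scale: "one_plus v (r *\<^sub>R x) = r *\<^sub>R one_plus v x" for v x :: 'a and r
    by (simp add: one_plus_def algebra_simps)
  have add: "one_plus v (x + z) = one_plus v x + one_plus v z" for v x z :: 'a
    by (simp add: one_plus_def algebra_simps)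
  have c: "?U (?V x) = x" "?V (?U x) = x" for x
    using one_plus_star_cancel[OF assms] one_plus_star_cancel[OF quasi_unitary_star[OF assms]]
    by (simp_all add: star_star)
  show "cos_op w (Suc n) y - one_minus_cos w * cos_op w (Suc n) y
      = (1/2) *\<^sub>R (cos_op w (Suc (Suc n)) y + cos_op w n y)"
    unfolding one_minus_cos_eq cos_op_def scale funpow.simps o_apply add c
    by (simp add: algebra_simps)
qed

text \<open>The cosine series of \<open>f\<close> at \<open>\<theta>\<close>, applied to \<open>y\<close>; only the even part of \<open>f\<close> matters.\<close>

definition calc :: "'a::cstar_algebra \<Rightarrow> (real \<Rightarrow> real) \<Rightarrow> 'a \<Rightarrow> 'a" where
  "calc w f y = (\<Sum>n. (if n = 0 then 1/2 else 1) *\<^sub>R fourier_coeff f n *\<^sub>R cos_op w n y)"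

text \<open>The 8 is the \<open>2 ^ Suc k\<close> of \<open>fourier_coeff_decay\<close> at
  \<open>k = 2\<close>, the decay order used for absolute convergence.\<close>

definition calc_const :: real where
  "calc_const = (\<Sum>n. 8 / real (Suc n) ^ 2)"

lemma summable_calc_const: "summable (\<lambda>n. 8 / real (Suc n) ^ 2)"
proof -
  have "summable (\<lambda>n. inverse (real (Suc n) ^ 2))"
    using inverse_power_summable[of 2, where 'a = real] by (subst summable_Suc_iff) simp
  from summable_mult[OF this, of 8] show ?thesis by (simp add: divide_inverse)
qed

lemma calc_const_nonneg: "0 \<le> calc_const"
  unfolding calc_const_def by (intro suminf_nonneg summable_calc_const) simp

text \<open>The indices of coefficient and operator are decoupled, so that one estimate covers all
  shifted series in the product formula for \<open>cos\<close>.\<close>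

lemma calc_term_le:
  assumes "quasi_unitary w" "periodic_Ck 2 f" "Ck_bdd 2 UNIV f M"
  shows "norm (fourier_coeff f (n + i) *\<^sub>R cos_op w j y) \<le> (8 / real (Suc n) ^ 2) * (M * norm y)"
proof -
  have M: "0 \<le> M" using Ck_bdd_norm_le[OF assms(3), of 0] by (simp add: order_trans[OF abs_ge_zero])
  have "\<bar>fourier_coeff f (n + i)\<bar> \<le> 8 * M / real (Suc (n + i)) ^ 2"
    using fourier_coeff_decay[OF assms(2,3), of "n + i"] by (simp add: eval_nat_numeral)
  also have "\<dots> \<le> 8 * M / real (Suc n) ^ 2"
    using M by (intro divide_left_mono power_mono mult_pos_pos) auto
  finally have "\<bar>fourier_coeff f (n + i)\<bar> * norm (cos_op w j y) \<le> 8 * M / real (Suc n) ^ 2 * norm y"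
    using M by (intro mult_mono norm_cos_op_le assms) auto
  then show ?thesis by (simp add: mult_ac)
qed

lemma calc_summable:
  assumes "quasi_unitary w" "periodic_Ck 2 f"
  shows "summable (\<lambda>n. fourier_coeff f (n + i) *\<^sub>R cos_op w (n + j) y)"
proof -
  obtain M where "Ck_bdd 2 UNIV f M" using periodic_Ck_bounded[OF assms(2)] by blast
  then show ?thesis
    using calc_term_le[OF assms] by (intro summable_comparison_test'[OF summable_mult2[OF summable_calc_const], of 0]) auto
qed

lemma calc_eq:
  assumes "quasi_unitary w" "periodic_Ck 2 f"
  shows "calc w f y = (fourier_coeff f 0 / 2) *\<^sub>R y + (\<Sum>n. fourier_coeff f (Suc n) *\<^sub>R cos_op w (Suc n) y)"
proof -
  have s: "summable (\<lambda>n. (if n = 0 then 1/2 else 1) *\<^sub>R fourier_coeff f n *\<^sub>R cos_op w n y)"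
    using calc_summable[OF assms, of 1 1 y] by (subst summable_Suc_iff[symmetric]) simp
  show ?thesis using suminf_split_head[OF s] by (simp add: calc_def algebra_simps)
qed

text \<open>Stands in for the supremum bound of spectral calculus. Derivatives up to order 2 enter
  because they make the coefficients absolutely summable.\<close>

lemma norm_calc_le:
  assumes "quasi_unitary w" "periodic_Ck 2 f" "Ck_bdd 2 UNIV f M"
  shows "norm (calc w f y) \<le> calc_const * M * norm y"
proof -
  have "norm (calc w f y) \<le> (\<Sum>n. 8 / real (Suc n) ^ 2 * (M * norm y))"
    unfolding calc_def
  proof (intro norm_suminf_le summable_mult2 summable_calc_const)
    show "norm ((if n = 0 then 1/2 else 1) *\<^sub>R fourier_coeff f n *\<^sub>R cos_op w n y)
        \<le> 8 / real (Suc n) ^ 2 * (M * norm y)" for n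
    proof -
      have "norm ((if n = 0 then 1/2 else 1) *\<^sub>R v) \<le> norm v" for v :: 'a by simp
      from order_trans[OF this calc_term_le[OF assms, of n 0 n y, unfolded add_0_right]] show ?thesis .
    qed
  qed
  also have "\<dots> = calc_const * M * norm y"
    using suminf_mult2[OF summable_calc_const, of "M * norm y"] by (simp only: calc_const_def mult.assoc)
  finally show ?thesis .
qed

lemma calc_diff:
  assumes "quasi_unitary w" "periodic_Ck 2 f" "periodic_Ck 2 g"
  shows "calc w (\<lambda>t. f t - g t) y = calc w f y - calc w g y"
proof -
  have "(\<Sum>n. fourier_coeff f (Suc n) *\<^sub>R cos_op w (Suc n) y) - (\<Sum>n. fourier_coeff g (Suc n) *\<^sub>R cos_op w (Suc n) y)
     = (\<Sum>n. fourier_coeff f (Suc n) *\<^sub>R cos_op w (Suc n) y - fourier_coeff g (Suc n) *\<^sub>R cos_op w (Suc n) y)"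
    using calc_summable[OF assms(1,2), of 1 1 y] calc_summable[OF assms(1,3), of 1 1 y]
    by (intro suminf_diff) simp_all
  then show ?thesis
    using assms by (simp add: calc_eq periodic_Ck_diff fourier_coeff_diff[OF assms(2,3)]
        algebra_simps diff_divide_distrib)
qed

lemma calc_1: "quasi_unitary w \<Longrightarrow> calc w (\<lambda>t. 1) y = y"
  by (simp add: calc_eq fourier_coeff_1)

text \<open>Averaging neighbouring coefficients and averaging neighbouring \<open>cos_op\<close> are
  the same operation up to reindexing. Further on, products are taken only with powers of
  \<open>1 - cos\<close>, which iterate this rule.\<close>

lemma calc_cos_mult:
  assumes "quasi_unitary w" "periodic_Ck 2 f"
  shows "calc w (\<lambda>t. cos t * f t) y = calc w f y - one_minus_cos w * calc w f y"
proof -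
  let ?c = "fourier_coeff f" and ?t = "\<lambda>n. cos_op w n y"
  \<comment> \<open>\<open>T\<close> is multiplication by \<open>Re u\<close>, written as the
    identity minus \<open>one_minus_cos w\<close>.\<close>
  define T where "T z = z - one_minus_cos w * z" for z
  have bl: "bounded_linear T" unfolding T_def
    by (intro bounded_linear_sub bounded_linear_ident bounded_linear_mult_right)
  note s = calc_summable[OF assms, of _ _ y]
  have s': "summable (\<lambda>n. ?c (Suc n) *\<^sub>R ?t (Suc n))" "summable (\<lambda>n. ?c (Suc n) *\<^sub>R ?t (Suc (Suc n)))"
     "summable (\<lambda>n. ?c (Suc n) *\<^sub>R ?t n)" "summable (\<lambda>n. ?c n *\<^sub>R ?t (Suc n))"
     "summable (\<lambda>n. ?c (Suc (Suc n)) *\<^sub>R ?t (Suc n))"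
    using s[of 1 1] s[of 1 2] s[of 1 0] s[of 0 1] s[of 2 1] by simp_all
  have T: "T (?t 0) = ?t 1" "T (?t (Suc n)) = (1/2) *\<^sub>R (?t (Suc (Suc n)) + ?t n)" for n
    unfolding T_def by (rule cos_op_step[OF assms(1)])+
  have "T (calc w f y) = (?c 0 / 2) *\<^sub>R ?t 1 + (\<Sum>n. ?c (Suc n) *\<^sub>R T (?t (Suc n)))"
    using T(1) bounded_linear.suminf[OF bl s'(1)]
    by (simp add: calc_eq[OF assms] linear_add[OF bounded_linear.linear[OF bl]]
        linear_cmul[OF bounded_linear.linear[OF bl]])
  also have "(\<Sum>n. ?c (Suc n) *\<^sub>R T (?t (Suc n)))
      = (\<Sum>n. (1/2) *\<^sub>R (?c (Suc n) *\<^sub>R ?t (Suc (Suc n))) + (1/2) *\<^sub>R (?c (Suc n) *\<^sub>R ?t n))"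
    by (simp add: T(2) scaleR_add_right mult.commute)
  also have "\<dots> = (1/2) *\<^sub>R (\<Sum>n. ?c (Suc n) *\<^sub>R ?t (Suc (Suc n))) + (1/2) *\<^sub>R (\<Sum>n. ?c (Suc n) *\<^sub>R ?t n)"
    using s' by (simp only: suminf_add[symmetric] summable_scaleR_right suminf_scaleR_right)
  \<comment> \<open>Splitting off the term of index 0 aligns the remainder with the coefficients of
    \<open>cos t * f t\<close>.\<close>
  also have "(\<Sum>n. ?c (Suc n) *\<^sub>R ?t n) = ?c 1 *\<^sub>R ?t 0 + (\<Sum>n. ?c (Suc (Suc n)) *\<^sub>R ?t (Suc n))"
    using suminf_split_head[OF s'(3)] by (simp add: algebra_simps)
  finally have L: "T (calc w f y) = (?c 0 / 2) *\<^sub>R ?t 1 + ((1/2) *\<^sub>R (\<Sum>n. ?c (Suc n) *\<^sub>R ?t (Suc (Suc n)))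
      + (1/2) *\<^sub>R (?c 1 *\<^sub>R ?t 0 + (\<Sum>n. ?c (Suc (Suc n)) *\<^sub>R ?t (Suc n))))" .
  have "calc w (\<lambda>t. cos t * f t) y = (?c 1 / 2) *\<^sub>R ?t 0
      + (\<Sum>n. (1/2) *\<^sub>R (?c (Suc (Suc n)) *\<^sub>R ?t (Suc n)) + (1/2) *\<^sub>R (?c n *\<^sub>R ?t (Suc n)))"
    using assms by (simp add: calc_eq periodic_Ck_mult fourier_coeff_cos_mult[OF assms(2)]
        add_divide_distrib scaleR_add_left)
  also have "(\<Sum>n. (1/2) *\<^sub>R (?c (Suc (Suc n)) *\<^sub>R ?t (Suc n)) + (1/2) *\<^sub>R (?c n *\<^sub>R ?t (Suc n)))
      = (1/2) *\<^sub>R (\<Sum>n. ?c (Suc (Suc n)) *\<^sub>R ?t (Suc n)) + (1/2) *\<^sub>R (\<Sum>n. ?c n *\<^sub>R ?t (Suc n))"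
    using s' by (simp only: suminf_add[symmetric] summable_scaleR_right suminf_scaleR_right)
  also have "(\<Sum>n. ?c n *\<^sub>R ?t (Suc n)) = ?c 0 *\<^sub>R ?t 1 + (\<Sum>n. ?c (Suc n) *\<^sub>R ?t (Suc (Suc n)))"
    using suminf_split_head[OF s'(4)] by (simp add: algebra_simps)
  finally show ?thesis using L by (simp add: T_def algebra_simps)
qed

lemma calc_one_minus_cos_power:
  assumes "quasi_unitary w" "periodic_Ck 2 f"
  shows "calc w (\<lambda>t. (1 - cos t) ^ n * f t) y = (((*) (one_minus_cos w)) ^^ n) (calc w f y)"
proof (induction n)
  case (Suc n)
  let ?g = "\<lambda>t. (1 - cos t) ^ n * f t"
  have g: "periodic_Ck 2 ?g"
    by (intro periodic_Ck_mult periodic_Ck_power periodic_Ck_diff periodic_Ck_const periodic_Ck_cos assms)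
  have "(\<lambda>t. (1 - cos t) ^ Suc n * f t) = (\<lambda>t. ?g t - cos t * ?g t)" by (simp add: algebra_simps)
  then show ?case
    using Suc by (simp add: calc_diff calc_cos_mult periodic_Ck_mult g assms(1))
qed simp

text \<open>Repeated products would cost a factor 4 per power. Instead \<open>q / Q = 1 + w\<close>
  is a contraction on the algebra of reals, so \<open>Ck_bdd_one_plus_iterate\<close> gives
  polynomial growth and the geometric rate is \<open>Q\<close> itself.\<close>

lemma power_bounded_multiplier:
  assumes "periodic_Ck 2 f" "periodic_Ck 2 q" "\<And>t. \<bar>q t\<bar> \<le> Q" "0 < Q"
  shows "\<exists>C\<ge>0. \<exists>e::nat. \<forall>n. Ck_bdd 2 UNIV (\<lambda>t. q t ^ n * f t) (C * real (Suc n) ^ e * Q ^ n)"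
proof -
  define w where "w t = q t * inverse Q - 1" for t
  have iter: "(one_plus (w t) ^^ n) y = (q t / Q) ^ n * y" for t n y
    by (induction n) (auto simp: one_plus_def w_def algebra_simps divide_inverse)
  have "periodic_Ck 2 w" unfolding w_def
    by (intro periodic_Ck_diff periodic_Ck_mult periodic_Ck_const assms)
  then obtain W where W: "0 \<le> W" "Ck_bdd 2 UNIV w W" using periodic_Ck_bounded by blast
  obtain M where M: "0 \<le> M" "Ck_bdd 2 UNIV f M" using periodic_Ck_bounded[OF assms(1)] by blast
  have "norm (one_plus (w t) y) \<le> norm y" for t y
  proof -
    have "\<bar>q t / Q\<bar> \<le> 1" using assms(3)[of t] assms(4) by (simp add: field_simps)
    then have "\<bar>q t / Q\<bar> * \<bar>y\<bar> \<le> \<bar>y\<bar>" by (simp only: mult_left_le_one_le abs_ge_zero)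
    moreover have "one_plus (w t) y = q t / Q * y" using iter[where t = t and n = 1 and y = y] by simp
    ultimately show ?thesis by (simp only: real_norm_def abs_mult)
  qed
  then obtain C e where C: "0 \<le> C" "\<And>n. Ck_bdd 2 UNIV (\<lambda>t. (one_plus (w t) ^^ n) (f t)) (C * real (Suc n) ^ e * M)"
    using Ck_bdd_one_plus_iterate[OF open_UNIV W(2,1)] M by blast
  have "Ck_bdd 2 UNIV (\<lambda>t. q t ^ n * f t) (C * M * real (Suc n) ^ e * Q ^ n)" for n
    using Ck_bdd_scaleR[OF open_UNIV C(2)[of n], of "Q ^ n"] assms(4)
    by (simp add: iter power_divide mult_ac del: of_nat_Suc)
  then show ?thesis using C(1) M(1) by (intro exI[of _ "C * M"] conjI exI[of _ e]) auto
qed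

lemma calc_multiplier_growth:
  assumes "quasi_unitary w" "periodic_Ck 2 f" "periodic_Ck 2 q" "\<And>t. \<bar>q t\<bar> \<le> Q" "0 < Q"
  shows "\<exists>C\<ge>0. \<exists>e::nat. \<forall>n. norm (calc w (\<lambda>t. q t ^ n * f t) y) \<le> C * real (Suc n) ^ e * Q ^ n"
proof -
  obtain C e where C: "0 \<le> C" "\<And>n. Ck_bdd 2 UNIV (\<lambda>t. q t ^ n * f t) (C * real (Suc n) ^ e * Q ^ n)"
    using power_bounded_multiplier[OF assms(2-5)] by blast
  have "norm (calc w (\<lambda>t. q t ^ n * f t) y) \<le> (calc_const * C * norm y) * real (Suc n) ^ e * Q ^ n" for n
    using norm_calc_le[OF assms(1) _ C(2), of n y] assms(2,3)
    by (simp add: periodic_Ck_mult periodic_Ck_power mult_ac del: of_nat_Suc)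
  then show ?thesis using C(1) calc_const_nonneg
    by (intro exI[of _ "calc_const * C * norm y"] conjI exI[of _ e]) auto
qed

lemma polynomial_times_power_tendsto_0:
  fixes x :: real
  assumes "0 \<le> x" "x < 1"
  shows "(\<lambda>n. real (Suc n) ^ e * x ^ n) \<longlonglongrightarrow> 0"
proof (cases "x = 0")
  case True
  then have "(\<lambda>n. real (Suc (n + 1)) ^ e * x ^ (n + 1)) \<longlonglongrightarrow> 0" by simp
  then show ?thesis by (rule LIMSEQ_offset)
next
  case False
  define L where "L = - ln x"
  have L: "L > 0" "x = exp (- L)" using assms False by (auto simp: L_def)
  have "filterlim (\<lambda>n. L * real (Suc n)) at_top sequentially"
    using L(1) by (intro filterlim_tendsto_pos_mult_at_top[OF tendsto_const]
        filterlim_compose[OF filterlim_real_sequentially filterlim_Suc])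
  from filterlim_compose[OF tendsto_power_div_exp_0 this]
  have "(\<lambda>n. inverse (x * L ^ e) * ((L * real (Suc n)) ^ e / exp (L * real (Suc n)))) \<longlonglongrightarrow> inverse (x * L ^ e) * 0"
    by (intro tendsto_mult tendsto_const)
  moreover have "inverse (x * L ^ e) * ((L * real (Suc n)) ^ e / exp (L * real (Suc n))) = real (Suc n) ^ e * x ^ n" for n
  proof -
    have "x ^ Suc n = inverse (exp (L * real (Suc n)))"
      unfolding L(2) exp_of_nat_mult[symmetric] by (simp add: exp_minus[symmetric] mult.commute)
    then have "inverse (x * L ^ e) * ((L * real (Suc n)) ^ e / exp (L * real (Suc n)))
        = inverse (x * L ^ e) * ((L * real (Suc n)) ^ e * x ^ Suc n)" by (simp add: divide_inverse)
    then show ?thesis using L(1) False by (simp add: power_mult_distrib field_simps del: of_nat_Suc)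
  qed
  ultimately show ?thesis by (simp only: mult_zero_right)
qed

text \<open>For \<open>a n = norm (h^(n+1))\<close> the C*-identity gives
  \<open>(a (n+1))^2 \<le> a n * a (n+2)\<close>. The ratios of successive terms therefore never
  decrease, and the first one is \<open>norm h\<close>.\<close>

lemma norm_mult_power_ge:
  fixes h :: "'a::cstar_algebra"
  assumes "h\<^sup>\<star> = h"
  shows "norm h ^ n * norm h \<le> norm ((((*) h) ^^ n) h)"
proof (cases "h = 0")
  case False
  let ?a = "\<lambda>n. norm ((((*) h) ^^ n) h)"
  have "norm h * ?a n \<le> ?a (Suc n) \<and> 0 < ?a n" for n
  proof (induction n)
    case 0
    then show ?case using False cstar_identity[of h] assms by (simp add: power2_eq_square)
  next
    case (Suc n)
    let ?y = "(((*) h) ^^ n) h"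
    have "(h * ?y)\<^sup>\<star> * (h * ?y) = ?y\<^sup>\<star> * (h * (h * ?y))" by (simp add: star_mult assms mult.assoc)
    then have "(?a (Suc n))\<^sup>2 \<le> ?a n * ?a (Suc (Suc n))"
      using cstar_identity[of "h * ?y"] norm_mult_ineq[of "?y\<^sup>\<star>" "h * (h * ?y)"] by (simp add: norm_star)
    moreover have "norm h * ?a n * ?a (Suc n) \<le> (?a (Suc n))\<^sup>2"
      using Suc mult_right_mono[of "norm h * ?a n" "?a (Suc n)" "?a (Suc n)"] by (simp add: power2_eq_square)
    ultimately have "?a n * (norm h * ?a (Suc n)) \<le> ?a n * ?a (Suc (Suc n))" by (simp add: mult_ac)
    moreover have "0 < norm h * ?a n" using Suc False by simp
    then have "0 < ?a (Suc n)" using Suc by linarith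
    ultimately show ?case using Suc by (simp only: mult_le_cancel_left_pos)
  qed
  then have *: "norm h * ?a n \<le> ?a (Suc n)" for n by blast
  show ?thesis
  proof (induction n)
    case (Suc n)
    have "norm h ^ Suc n * norm h = norm h * (norm h ^ n * norm h)" by simp
    also have "\<dots> \<le> norm h * ?a n" using Suc by (rule mult_left_mono) simp
    finally show ?case using *[of n] by linarith
  qed simp
qed simp

section \<open>The lower bound on elements \<open>1 - Re u\<close>\<close>

context cstar_normed_subalgebra
begin

text \<open>In \<open>F(h) h = h^n \<kappa>(h)^n F(h) h\<close> the factor \<open>h^n\<close> is
  measured by \<open>p\<close> and the rest by \<open>norm\<close>, so \<open>p\<close> of it decays
  like \<open>(p h / r0)^n\<close> and the element is 0. Then
  \<open>h^n h = q(h)^n (1 - F)(h) h\<close> grows at rate at most \<open>r3 < norm h\<close>,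
  against \<open>norm_mult_power_ge\<close>.\<close>

lemma p_one_minus_cos:
  assumes qi: "\<And>b d. b \<in> B \<Longrightarrow> norm b < 1 \<Longrightarrow> d = b + b * d \<Longrightarrow> d = b + d * b \<Longrightarrow> d \<in> B"
    and calc: "\<And>w f y. w \<in> B \<Longrightarrow> quasi_unitary w \<Longrightarrow> (\<And>k. periodic_Ck k f) \<Longrightarrow> y \<in> B \<Longrightarrow> calc w f y \<in> B"
    and w: "w \<in> B" "quasi_unitary w"
  shows "p (one_minus_cos w) = norm (one_minus_cos w)"
proof (rule ccontr)
  define h where "h = one_minus_cos w"
  have h: "h \<in> B" "h\<^sup>\<star> = h" using w(1) by (auto simp: h_def one_minus_cos_star) (simp add: one_minus_cos_def)
  have p_le: "p x \<le> norm x" if "x \<in> B" for x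
  proof (rule p_le_norm)
    show "d \<in> B" if "b \<in> B" "norm b < 1" "d = b + b * d" "d = b + d * b" for b d by (rule qi[OF that])
  qed (rule that)
  assume "p (one_minus_cos w) \<noteq> norm (one_minus_cos w)"
  then have "p h < norm h" using p_le[OF h(1)] by (simp add: h_def)
  \<comment> \<open>Four radii make room for three smooth transitions: that of \<kappa> between
    \<open>r0\<close> and \<open>r1\<close>, of \<open>F\<close> between \<open>r1\<close> and
    \<open>r2\<close>, of \<open>q\<close> between \<open>r2\<close> and \<open>r3\<close>.\<close>
  then obtain r0 where r0: "p h < r0" "r0 < norm h" using dense by blast
  obtain r1 where r1: "r0 < r1" "r1 < norm h" using dense[OF r0(2)] by blast
  obtain r2 where r2: "r1 < r2" "r2 < norm h" using dense[OF r1(2)] by blast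
  obtain r3 where r3: "r2 < r3" "r3 < norm h" using dense[OF r2(2)] by blast
  have pos: "0 \<le> p h" "0 < r0" "0 < r3" using p_nonneg[OF h(1) h(1)] r0 r1 r2 r3 by linarith+
  define x where "x t = 1 - cos t" for t :: real
  define F where "F t = smooth_step r1 r2 (x t)" for t
  \<comment> \<open>Equals \<open>1 / x\<close> wherever \<open>F\<close> is nonzero and is bounded
    by \<open>1 / r0\<close> everywhere; the added term keeps the denominator at least
    \<open>r0\<close> for small \<open>x\<close>.\<close>
  define \<kappa> where "\<kappa> t = inverse (x t + r0 * (1 - smooth_step r0 r1 (x t)))" for t
  \<comment> \<open>Equals \<open>x\<close> wherever \<open>F\<close> differs from 1, yet never
    exceeds \<open>r3\<close>.\<close>
  define q where "q t = x t * (1 - smooth_step r2 r3 (x t))" for t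
  have x0: "0 \<le> x t" for t by (simp add: x_def)
  have denom: "r0 \<le> x t + r0 * (1 - smooth_step r0 r1 (x t))" for t
  proof (cases "x t \<le> r0")
    case True
    then show ?thesis using smooth_step_eq_0[OF r1(1)] x0[of t] by simp
  next
    case False
    then show ?thesis using smooth_step_le_1[OF r1(1), of "x t"] pos(2)
      by (simp add: add_increasing2)
  qed
  have x: "periodic_Ck k x" for k
    unfolding x_def by (intro periodic_Ck_diff periodic_Ck_const periodic_Ck_cos)
  have F: "periodic_Ck k F" for k
    unfolding F_def by (intro periodic_Ck_smooth_step x r2)
  have \<kappa>: "periodic_Ck k \<kappa>" for k
    unfolding \<kappa>_def
  proof (intro periodic_Ck_inverse periodic_Ck_add periodic_Ck_mult periodic_Ck_diff
      periodic_Ck_const periodic_Ck_smooth_step x r1)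
    show "x t + r0 * (1 - smooth_step r0 r1 (x t)) \<noteq> 0" for t using denom[of t] pos(2) by linarith
  qed
  have q: "periodic_Ck k q" for k
    unfolding q_def by (intro periodic_Ck_mult periodic_Ck_diff periodic_Ck_const periodic_Ck_smooth_step x r3)
  have \<kappa>_le: "\<bar>\<kappa> t\<bar> \<le> inverse r0" for t
  proof -
    have "0 < x t + r0 * (1 - smooth_step r0 r1 (x t))" using denom[of t] pos(2) by linarith
    then show ?thesis using denom[of t] pos(2) by (simp add: \<kappa>_def le_imp_inverse_le)
  qed
  have q_le: "\<bar>q t\<bar> \<le> r3" for t
  proof (cases "r3 \<le> x t")
    case True
    then show ?thesis using smooth_step_eq_1[OF r3(1)] pos(3) by (simp add: q_def)
  next
    case False
    have "\<bar>q t\<bar> \<le> x t" using x0[of t] smooth_step_nonneg[OF r3(1), of "x t"] smooth_step_le_1[OF r3(1), of "x t"]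
      by (simp add: q_def abs_mult mult_left_le)
    then show ?thesis using False by simp
  qed
  have xF: "x t ^ n * (\<kappa> t ^ n * F t) = F t" for t n
  proof (cases "x t \<le> r1")
    case True
    then show ?thesis using smooth_step_eq_0[OF r2(1)] by (simp add: F_def)
  next
    case False
    then have "\<kappa> t = inverse (x t)" "x t \<noteq> 0" using smooth_step_eq_1[OF r1(1)] r1 pos by (auto simp: \<kappa>_def)
    then show ?thesis by (simp add: power_inverse mult.assoc[symmetric])
  qed
  have xq: "x t ^ n * (1 - F t) = q t ^ n * (1 - F t)" for t n
  proof (cases "x t \<le> r2")
    case True
    then show ?thesis using smooth_step_eq_0[OF r3(1)] by (simp add: q_def)
  next
    case False
    then show ?thesis using smooth_step_eq_1[OF r2(1)] by (simp add: F_def)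
  qed
  have step: "calc w (\<lambda>t. x t ^ n * f t) h = (((*) h) ^^ n) (calc w f h)" if "periodic_Ck 2 f" for f n
    unfolding h_def x_def by (rule calc_one_minus_cos_power[OF w(2) that])
  define z where "z = calc w F h"
  have zB: "z \<in> B" unfolding z_def by (intro calc w F h)
  have "z = 0"
  proof -
    obtain C e where C: "0 \<le> C" "\<And>n. norm (calc w (\<lambda>t. \<kappa> t ^ n * F t) h) \<le> C * real (Suc n) ^ e * inverse r0 ^ n"
      using calc_multiplier_growth[OF w(2) F \<kappa> \<kappa>_le, of h] pos(2) by auto
    have hB: "(((*) h) ^^ n) y \<in> B \<and> p ((((*) h) ^^ n) y) \<le> p h ^ n * p y" if "y \<in> B" for n y
    proof (induction n)
      case (Suc n)
      then have "p (h * (((*) h) ^^ n) y) \<le> p h * p ((((*) h) ^^ n) y)" using h by (intro p_mult) auto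
      also have "\<dots> \<le> p h * (p h ^ n * p y)" using Suc pos(1) by (intro mult_left_mono) auto
      finally show ?case using Suc h by simp
    qed (use that in simp)
    have "p z \<le> C * (real (Suc n) ^ e * (p h / r0) ^ n)" for n
    proof -
      let ?g = "\<lambda>t. \<kappa> t ^ n * F t"
      have g: "periodic_Ck k ?g" for k by (intro periodic_Ck_mult periodic_Ck_power F \<kappa>)
      \<comment> \<open>Membership in \<open>B\<close> uses smoothness of \<kappa> and
        \<open>F\<close> to all orders; it is what permits passing from \<open>p\<close> to
        \<open>norm\<close> for this factor.\<close>
      have gB: "calc w ?g h \<in> B" by (intro calc w g h)
      have "z = (((*) h) ^^ n) (calc w ?g h)" unfolding z_def step[OF g, symmetric] by (simp add: xF)
      then have "p z \<le> p h ^ n * p (calc w ?g h)" using hB[OF gB] by simp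
      also have "\<dots> \<le> p h ^ n * (C * real (Suc n) ^ e * inverse r0 ^ n)"
        using p_le[OF gB] C(2)[of n] pos(1) by (intro mult_left_mono) auto
      also have "\<dots> = C * (real (Suc n) ^ e * (p h / r0) ^ n)"
        by (simp add: power_mult_distrib divide_inverse mult_ac del: of_nat_Suc)
      finally show ?thesis .
    qed
    moreover have "(\<lambda>n. C * (real (Suc n) ^ e * (p h / r0) ^ n)) \<longlonglongrightarrow> C * 0"
      using r0 pos by (intro tendsto_mult tendsto_const polynomial_times_power_tendsto_0) auto
    ultimately have "p z \<le> 0" by (intro LIMSEQ_le_const) auto
    then show "z = 0" using p_eq_0[OF zB zB] p_nonneg[OF zB zB] by simp
  qed
  have F1: "periodic_Ck 2 (\<lambda>t. 1 - F t)" by (intro periodic_Ck_diff periodic_Ck_const F)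
  have "calc w (\<lambda>t. 1 - F t) h = h"
    using calc_diff[OF w(2) periodic_Ck_const F, of 1 h] \<open>z = 0\<close> calc_1[OF w(2)] by (simp add: z_def)
  then have eq: "(((*) h) ^^ n) h = calc w (\<lambda>t. q t ^ n * (1 - F t)) h" for n
    using step[OF F1, of n] by (simp add: xq)
  obtain C e where C: "0 \<le> C" "\<And>n. norm (calc w (\<lambda>t. q t ^ n * (1 - F t)) h) \<le> C * real (Suc n) ^ e * r3 ^ n"
    using calc_multiplier_growth[OF w(2) F1 q q_le pos(3), of h] by auto
  have hpos: "0 < norm h" using pos(3) r3(2) by linarith
  have "norm h \<le> C * (real (Suc n) ^ e * (r3 / norm h) ^ n)" for n
  proof -
    have "norm h ^ n * norm h \<le> C * real (Suc n) ^ e * r3 ^ n"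
      using norm_mult_power_ge[OF h(2), of n] C(2)[of n] by (simp add: eq)
    then show ?thesis using hpos by (simp add: power_divide field_simps del: of_nat_Suc)
  qed
  moreover have "(\<lambda>n. C * (real (Suc n) ^ e * (r3 / norm h) ^ n)) \<longlonglongrightarrow> C * 0"
    using r3 pos hpos by (intro tendsto_mult tendsto_const polynomial_times_power_tendsto_0) auto
  ultimately have "norm h \<le> 0" by (intro LIMSEQ_le_const) auto
  then show False using hpos by simp
qed

end

context cstar_normed_subalgebra
begin

text \<open>The Cayley transform only reaches \<open>b * b\<close>, since \<open>h\<close> depends
  on the square of \<open>b\<close>. With \<open>b = a\<^sup>\<star> * a\<close> the C*-identity
  then descends twice, to \<open>b\<close> and to \<open>a\<close>.\<close>

lemma p_eq_norm:
  assumes qi: "\<And>b d. b \<in> B \<Longrightarrow> norm b < 1 \<Longrightarrow> d = b + b * d \<Longrightarrow> d = b + d * b \<Longrightarrow> d \<in> B"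
    and calc: "\<And>w f y. w \<in> B \<Longrightarrow> quasi_unitary w \<Longrightarrow> (\<And>k. periodic_Ck k f) \<Longrightarrow> y \<in> B \<Longrightarrow> calc w f y \<in> B"
    and "a \<in> B"
  shows "p a = norm a"
proof -
  have p_le: "p x \<le> norm x" if "x \<in> B" for x
  proof (rule p_le_norm)
    show "d \<in> B" if "b \<in> B" "norm b < 1" "d = b + b * d" "d = b + d * b" for b d by (rule qi[OF that])
  qed (rule that)
  text \<open>The self-adjoint \<open>b\<close> is reached through the Cayley transform \<open>1 + w\<close> of \<open>sb\<close>, for which
    \<open>one_minus_cos w\<close> is asymptotically \<open>2 (sb)\<^sup>2\<close> as \<open>s \<rightarrow> 0\<close>.\<close>
  have approx: "norm (b * b) \<le> p (b * b) + norm (b * b) * (4 * (s * norm b))"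
    if b: "b \<in> B" "b\<^sup>\<star> = b" and s: "0 < s" "s * norm b \<le> 1 / 2" for b s
  proof -
    define e where "e = (\<i> * complex_of_real s) *\<^sub>C b"
    have e: "e \<in> B" "e\<^sup>\<star> = - e" using b by (auto simp: e_def star_scaleC scaleC_minus_left)
    have ne: "norm e = s * norm b" using s(1) by (simp add: e_def norm_scaleC norm_mult)
    have ee: "e * e = - (s\<^sup>2 *\<^sub>R (b * b))"
    proof -
      have "\<i> * complex_of_real s * (\<i> * complex_of_real s) = - complex_of_real (s\<^sup>2)"
        by (simp add: complex_eq_iff power2_eq_square)
      then show ?thesis
        by (simp only: e_def mult_scaleC_left mult_scaleC_right scaleC_scaleC scaleR_scaleC scaleC_minus_left)
    qed
    obtain d where d: "d = e + e * d" "d = e + d * e"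
      by (rule quasi_inverse_exists[of e]) (use s(2) ne in simp)
    \<comment> \<open>In unital notation, \<open>1 + d\<close> inverts \<open>1 - e\<close> and
      \<open>1 + f\<close> inverts \<open>1 + e\<close>, as \<open>e\<close> is
      skew-adjoint.\<close>
    define f where "f = d\<^sup>\<star>"
    have f: "f = - e - f * e" "f = - e - e * f"
    proof -
      have "(e + e * d)\<^sup>\<star> = - e - f * e" "(e + d * e)\<^sup>\<star> = - e - e * f"
        by (simp_all add: f_def star_add star_mult e(2))
      then show "f = - e - f * e" "f = - e - e * f"
        using arg_cong[OF d(1), of star] arg_cong[OF d(2), of star] unfolding f_def by (metis, metis)
    qed
    have dB: "d \<in> B" by (rule qi[OF e(1) _ d]) (use s(2) ne in simp)
    have ed: "e * d = d - e" "d * e = d - e" "e * f = - e - f" "f * e = - e - f"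
      using d f by (simp_all add: algebra_simps)
    have "d * f = e * f + d * (e * f)" using arg_cong[OF d(2), of "\<lambda>x. x * f"] by (simp add: algebra_simps)
    also have "\<dots> = - f - d - d * f" by (simp add: ed algebra_simps)
    finally have df: "d * f + d * f = - f - d" by (simp add: algebra_simps)
    have "f * d = - e * d - f * (e * d)" using arg_cong[OF f(1), of "\<lambda>x. x * d"] by (simp add: algebra_simps)
    also have "\<dots> = - f - d - f * d" by (simp add: ed algebra_simps)
    finally have fd: "f * d + f * d = - f - d" by (simp add: algebra_simps)
    \<comment> \<open>The Cayley transform \<open>(1 + e) (1 - e)^(-1)\<close> equals
      \<open>1 + 2 d\<close>, because \<open>e * d = d - e\<close>.\<close>
    define w where "w = d + d"
    have w: "(d + d)\<^sup>\<star> = f + f" by (simp add: f_def star_add)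
    have "w + w\<^sup>\<star> + w\<^sup>\<star> * w = (d + d) + (f + f) + ((f * d + f * d) + (f * d + f * d))"
      unfolding w_def w by (simp add: algebra_simps)
    moreover have "w + w\<^sup>\<star> + w * w\<^sup>\<star> = (d + d) + (f + f) + ((d * f + d * f) + (d * f + d * f))"
      unfolding w_def w by (simp add: algebra_simps)
    ultimately have wu: "quasi_unitary w" by (simp add: quasi_unitary_def df fd)
    have wB: "w \<in> B" using dB by (simp add: w_def)
    define h where "h = one_minus_cos w"
    have "h = - (d + f)"
    proof -
      have "(1/2) *\<^sub>R (x + x) = x" for x :: 'a by (simp flip: scaleR_2)
      from this[of "d + f"] show ?thesis by (simp add: h_def one_minus_cos_def w w_def algebra_simps)
    qed
    have hB: "h \<in> B" using wB by (simp add: h_def one_minus_cos_def)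
    have ph: "p h = norm h" unfolding h_def
    proof (rule p_one_minus_cos)
      show "d \<in> B" if "b \<in> B" "norm b < 1" "d = b + b * d" "d = b + d * b" for b d by (rule qi[OF that])
      show "calc w f y \<in> B" if "w \<in> B" "quasi_unitary w" "\<And>k. periodic_Ck k f" "y \<in> B" for w f y
        by (rule calc[OF that])
    qed (rule wB wu)+
    let ?g = "(b * b + b * b) - b * b * h"
    \<comment> \<open>This says \<open>h = 2 s^2 b^2 / (1 + s^2 b^2)\<close>, put as an equation
      without inverses. After division by \<open>s^2\<close> the deviation from \<open>2 b^2\<close>
      is exactly \<open>b^2 h\<close>.\<close>
    have hg: "h = s\<^sup>2 *\<^sub>R ?g"
    proof -
      have "e * e * h = - (e * (e * d)) - e * (e * f)" by (simp add: \<open>h = - (d + f)\<close> algebra_simps)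
      also have "\<dots> = h + (e * e + e * e)"
        by (simp add: ed \<open>h = - (d + f)\<close> algebra_simps)
      finally have "h = e * e * h - (e * e + e * e)" by (simp add: algebra_simps)
      then show ?thesis by (simp add: ee algebra_simps)
    qed
    have gB: "?g \<in> B" using b hB by simp
    have "p ?g = norm ?g"
    proof -
      have "s\<^sup>2 * p ?g = s\<^sup>2 * norm ?g"
        using ph p_scaleR[OF gB gB, of "s\<^sup>2"] norm_scaleR[of "s\<^sup>2" ?g] hg by simp
      then show ?thesis using s(1) by simp
    qed
    have nd: "norm d \<le> 2 * norm e"
    proof -
      have "norm d \<le> norm e + norm (e * d)" using d(1) norm_triangle_ineq[of e "e * d"] by simp
      also have "norm (e * d) \<le> 1 / 2 * norm d"
        using norm_mult_ineq[of e d] mult_right_mono[of "norm e" "1/2" "norm d"] s(2) ne by simp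
      finally show ?thesis by simp
    qed
    \<comment> \<open>The 4 comes from the two terms \<open>d\<close> and \<open>f\<close>, each of
      norm at most \<open>2 * norm e\<close>.\<close>
    have nh: "norm h \<le> 4 * (s * norm b)"
    proof -
      have "norm h = norm (d + f)" unfolding \<open>h = - (d + f)\<close> by (rule norm_minus_cancel)
      also have "\<dots> \<le> norm d + norm d" using norm_triangle_ineq[of d f] by (simp add: f_def norm_star)
      finally show ?thesis using nd ne by simp
    qed
    have bbh: "norm (b * b * h) \<le> norm (b * b) * (4 * (s * norm b))"
      using norm_mult_ineq[of "b * b" h] mult_left_mono[OF nh, of "norm (b * b)"] by simp
    have "2 * norm (b * b) = norm (?g + b * b * h)" by (simp flip: scaleR_2)
    also have "\<dots> \<le> norm ?g + norm (b * b * h)" by (rule norm_triangle_ineq)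
    also have "norm ?g \<le> p (b * b + b * b) + p (b * b * h)"
      unfolding \<open>p ?g = norm ?g\<close>[symmetric] using b hB by (intro p_triangle_diff) auto
    also have "p (b * b + b * b) \<le> 2 * p (b * b)" using p_triangle[of "b * b" "b * b"] b by simp
    also have "p (b * b * h) \<le> norm (b * b * h)" using b hB by (intro p_le) simp
    finally show ?thesis using bbh by simp
  qed
  have square: "p (b * b) = norm (b * b)" if b: "b \<in> B" "b\<^sup>\<star> = b" for b
  proof (rule antisym)
    show "p (b * b) \<le> norm (b * b)" using b by (intro p_le) simp
    show "norm (b * b) \<le> p (b * b)"
    proof (rule tendsto_lowerbound)
      show "((\<lambda>s. p (b * b) + norm (b * b) * (4 * (s * norm b))) \<longlongrightarrow> p (b * b)) (at_right 0)"
        by (auto intro!: tendsto_eq_intros)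
      have "((\<lambda>s. s * norm b) \<longlongrightarrow> 0) (at_right 0)" by (auto intro!: tendsto_eq_intros)
      then have "\<forall>\<^sub>F s in at_right 0. s * norm b < 1 / 2" by (rule order_tendstoD) simp
      then show "\<forall>\<^sub>F s in at_right 0. norm (b * b) \<le> p (b * b) + norm (b * b) * (4 * (s * norm b))"
        using eventually_at_right_less[of 0] by eventually_elim (use approx[OF b] in auto)
    qed simp
  qed
  define b where "b = a\<^sup>\<star> * a"
  have b: "b \<in> B" "b\<^sup>\<star> = b" using assms(3) by (auto simp: b_def star_mult star_star)
  have "(p b)\<^sup>2 = (norm b)\<^sup>2"
    using square[OF b] p_star_mult[OF b(1,1)] cstar_identity[of b] b(2) by simp
  then have "p b = norm b" using p_nonneg[OF b(1,1)] by simp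
  then have "(p a)\<^sup>2 = (norm a)\<^sup>2"
    using p_star_mult[OF assms(3,3)] cstar_identity[of a] by (simp add: b_def)
  then show ?thesis using p_nonneg[OF assms(3,3)] by simp
qed

end

section \<open>Smooth elements\<close>

text \<open>The action read in a single chart: \<open>\<beta> x\<close> is the automorphism attached
  to the point with coordinates \<open>x\<close>.\<close>

locale local_star_action =
  fixes S :: "'e::real_normed_vector set" and \<beta> :: "'e \<Rightarrow> 'a::cstar_algebra \<Rightarrow> 'a"
  assumes finite_dim: "\<exists>B::'e set. finite B \<and> span B = UNIV"
    and open_S: "open S"
    and aut: "\<And>x. x \<in> S \<Longrightarrow> star_automorphism (\<beta> x)"
    and cont: "\<And>a. continuous_on S (\<lambda>x. \<beta> x a)"
begin

definition smooth_vectors :: "'a set" where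
  "smooth_vectors = {a. smooth_on S (\<lambda>x. \<beta> x a)}"

lemma aut_simps:
  assumes "x \<in> S"
  shows "\<beta> x (a + b) = \<beta> x a + \<beta> x b" "\<beta> x (z *\<^sub>C a) = z *\<^sub>C \<beta> x a"
    "\<beta> x (a * b) = \<beta> x a * \<beta> x b" "\<beta> x (a\<^sup>\<star>) = (\<beta> x a)\<^sup>\<star>"
    "\<beta> x (r *\<^sub>R a) = r *\<^sub>R \<beta> x a" "\<beta> x 0 = 0"
  using aut[OF assms] by (auto simp: star_automorphism_def scaleR_scaleC) (metis add_cancel_right_right)

lemma bounded_linear_aut: "x \<in> S \<Longrightarrow> bounded_linear (\<beta> x)"
  by (rule bounded_linear_intro[where K = 1])
    (auto simp: aut_simps star_automorphism_contraction[OF aut])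

lemma star_subalgebra_smooth_vectors: "star_subalgebra smooth_vectors"
proof -
  note cong = Ck_on_cong[OF open_S]
  have "Ck_on k S (\<lambda>x. \<beta> x 0)" for k
    by (rule cong[OF _ Ck_on_const[OF open_S]]) (simp add: aut_simps)
  moreover have "Ck_on k S (\<lambda>x. \<beta> x (a + b))"
    if "Ck_on k S (\<lambda>x. \<beta> x a)" "Ck_on k S (\<lambda>x. \<beta> x b)" for a b k
    by (rule cong[OF _ Ck_on_add[OF open_S that]]) (simp add: aut_simps)
  moreover have "Ck_on k S (\<lambda>x. \<beta> x (a * b))"
    if "Ck_on k S (\<lambda>x. \<beta> x a)" "Ck_on k S (\<lambda>x. \<beta> x b)" for a b k
    by (rule cong[OF _ Ck_on_mult[OF open_S that]]) (simp add: aut_simps)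
  moreover have "Ck_on k S (\<lambda>x. \<beta> x (a\<^sup>\<star>))" if "Ck_on k S (\<lambda>x. \<beta> x a)" for a k
    by (rule cong[OF _ Ck_on_linear[OF open_S bounded_linear_star that]]) (simp add: aut_simps)
  moreover have "Ck_on k S (\<lambda>x. \<beta> x (z *\<^sub>C a))" if "Ck_on k S (\<lambda>x. \<beta> x a)" for a z k
    by (rule cong[OF _ Ck_on_linear[OF open_S bounded_linear_scaleC that]]) (simp add: aut_simps)
  ultimately show ?thesis by (simp add: star_subalgebra_def smooth_vectors_def smooth_on_def)
qed

text \<open>Each automorphism carries both defining equations over to \<open>\<beta> x d\<close>.
  Strong continuity makes this continuous in \<open>x\<close>, which is the starting point of
  \<open>Ck_on_quasi_inverse\<close>.\<close>

lemma quasi_inverse_smooth_vectors: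
  assumes "b \<in> smooth_vectors" "d = b + b * d" "d = b + d * b"
  shows "d \<in> smooth_vectors"
proof -
  have "Ck_on k S (\<lambda>x. \<beta> x d)" for k
  proof (rule Ck_on_quasi_inverse[OF open_S _ cont])
    show "Ck_on k S (\<lambda>x. \<beta> x b)" using assms(1) by (simp add: smooth_vectors_def smooth_on_def)
    show "\<beta> x d = \<beta> x b + \<beta> x b * \<beta> x d" if "x \<in> S" for x
      using arg_cong[OF assms(2), of "\<beta> x"] unfolding aut_simps[OF that] .
    show "\<beta> x d = \<beta> x b + \<beta> x d * \<beta> x b" if "x \<in> S" for x
      using arg_cong[OF assms(3), of "\<beta> x"] unfolding aut_simps[OF that] .
  qed
  then show ?thesis by (simp add: smooth_vectors_def smooth_on_def)
qed

lemma quasi_unitary_aut: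
  assumes "x \<in> S" "quasi_unitary w"
  shows "quasi_unitary (\<beta> x w)"
proof -
  have "w + w\<^sup>\<star> + w\<^sup>\<star> * w = 0" "w + w\<^sup>\<star> + w * w\<^sup>\<star> = 0"
    using assms(2) by (simp_all add: quasi_unitary_def)
  from this[THEN arg_cong[of _ _ "\<beta> x"]] show ?thesis
    unfolding quasi_unitary_def aut_simps[OF assms(1)] by (rule conjI)
qed

lemma aut_cos_op:
  assumes "x \<in> S"
  shows "\<beta> x (cos_op w n y) = cos_op (\<beta> x w) n (\<beta> x y)"
proof -
  have "\<beta> x ((one_plus v ^^ n) y) = (one_plus (\<beta> x v) ^^ n) (\<beta> x y)" for v
    by (induction n) (auto simp: one_plus_def aut_simps[OF assms])
  then show ?thesis by (simp add: cos_op_def aut_simps[OF assms])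
qed

lemma aut_calc:
  assumes "x \<in> S" "quasi_unitary w" "periodic_Ck 2 f"
  shows "\<beta> x (calc w f y) = (\<Sum>n. (if n = 0 then 1/2 else 1) *\<^sub>R fourier_coeff f n *\<^sub>R cos_op (\<beta> x w) n (\<beta> x y))"
proof -
  have "summable (\<lambda>n. (if n = 0 then 1/2 else 1) *\<^sub>R fourier_coeff f n *\<^sub>R cos_op w n y)"
    using calc_summable[OF assms(2,3), of 1 1 y] by (subst summable_Suc_iff[symmetric]) simp
  from bounded_linear.suminf[OF bounded_linear_aut[OF assms(1)] this] show ?thesis
    by (simp only: calc_def aut_simps[OF assms(1)] aut_cos_op[OF assms(1)])
qed

text \<open>One neighbourhood and one exponent must serve all \<open>n\<close>; smoothness of each
  term alone would let the neighbourhoods shrink. So only \<open>w\<close> and \<open>y\<close> are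
  bounded locally, and the iterates of \<open>w\<close> and of its adjoint inherit the
  bound.\<close>

lemma Ck_bdd_cos_op:
  assumes "w \<in> smooth_vectors" "y \<in> smooth_vectors" "quasi_unitary w" "x0 \<in> S"
  shows "\<exists>N C (e::nat). open N \<and> x0 \<in> N \<and> N \<subseteq> S \<and> 0 \<le> C
    \<and> (\<forall>n. Ck_bdd k N (\<lambda>x. cos_op (\<beta> x w) n (\<beta> x y)) (C * real (Suc n) ^ e))"
proof -
  have bdd: "\<exists>N M. open N \<and> x0 \<in> N \<and> N \<subseteq> S \<and> Ck_bdd k N (\<lambda>x. \<beta> x a) M" if "a \<in> smooth_vectors" for a
  proof (rule Ck_on_locally_bdd[OF finite_dim open_S _ assms(4)])
    show "Ck_on k S (\<lambda>x. \<beta> x a)" using that by (simp add: smooth_vectors_def smooth_on_def)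
  qed
  obtain N1 W where N1: "open N1" "x0 \<in> N1" "N1 \<subseteq> S" "Ck_bdd k N1 (\<lambda>x. \<beta> x w) W"
    using bdd[OF assms(1)] by blast
  obtain N2 M where N2: "open N2" "x0 \<in> N2" "N2 \<subseteq> S" "Ck_bdd k N2 (\<lambda>x. \<beta> x y) M"
    using bdd[OF assms(2)] by blast
  define N where "N = N1 \<inter> N2"
  have N: "open N" "x0 \<in> N" "N \<subseteq> S" using N1 N2 by (auto simp: N_def)
  have w: "Ck_bdd k N (\<lambda>x. \<beta> x w) W" and y: "Ck_bdd k N (\<lambda>x. \<beta> x y) M"
    using Ck_bdd_subset[OF N1(4)] Ck_bdd_subset[OF N2(4)] by (auto simp: N_def)
  have W: "0 \<le> W" and M: "0 \<le> M"
    using Ck_bdd_norm_le[OF w N(2)] Ck_bdd_norm_le[OF y N(2)] norm_ge_zero order_trans by blast+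
  have w': "Ck_bdd k N (\<lambda>x. (\<beta> x w)\<^sup>\<star>) W"
    using Ck_bdd_linear[OF N(1) bounded_linear_star _ _ w, of 1] by (simp add: norm_star)
  have u: "quasi_unitary (\<beta> x w)" "quasi_unitary ((\<beta> x w)\<^sup>\<star>)" if "x \<in> N" for x
    using that N(3) quasi_unitary_aut assms(3) quasi_unitary_star by blast+
  obtain C1 and e1 :: nat where C1: "0 \<le> C1"
      "\<And>n. Ck_bdd k N (\<lambda>x. (one_plus (\<beta> x w) ^^ n) (\<beta> x y)) (C1 * real (Suc n) ^ e1 * M)"
    using Ck_bdd_one_plus_iterate[OF N(1) w W eq_refl[OF norm_one_plus[OF u(1)]]] M y by blast
  obtain C2 and e2 :: nat where C2: "0 \<le> C2"
      "\<And>n. Ck_bdd k N (\<lambda>x. (one_plus ((\<beta> x w)\<^sup>\<star>) ^^ n) (\<beta> x y)) (C2 * real (Suc n) ^ e2 * M)"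
    using Ck_bdd_one_plus_iterate[OF N(1) w' W eq_refl[OF norm_one_plus[OF u(2)]]] M y by blast
  have "Ck_bdd k N (\<lambda>x. cos_op (\<beta> x w) n (\<beta> x y)) ((C1 + C2) * M * real (Suc n) ^ (e1 + e2))" for n
  proof -
    have "Ck_bdd k N (\<lambda>x. cos_op (\<beta> x w) n (\<beta> x y))
        (\<bar>1/2\<bar> * (C1 * real (Suc n) ^ e1 * M + C2 * real (Suc n) ^ e2 * M))"
      unfolding cos_op_def by (intro Ck_bdd_scaleR Ck_bdd_add N(1) C1 C2)
    then show ?thesis
    proof (rule Ck_bdd_mono)
      have "C1 * real (Suc n) ^ e1 * M \<le> C1 * real (Suc n) ^ (e1 + e2) * M"
        "C2 * real (Suc n) ^ e2 * M \<le> C2 * real (Suc n) ^ (e1 + e2) * M"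
        using C1(1) C2(1) M by (intro mult_right_mono mult_left_mono power_increasing; simp)+
      moreover have "0 \<le> C1 * real (Suc n) ^ e1 * M" "0 \<le> C2 * real (Suc n) ^ e2 * M" using C1(1) C2(1) M by simp_all
      moreover have "(C1 + C2) * M * real (Suc n) ^ (e1 + e2)
          = C1 * real (Suc n) ^ (e1 + e2) * M + C2 * real (Suc n) ^ (e1 + e2) * M" by (simp add: algebra_simps)
      ultimately show "\<bar>1/2\<bar> * (C1 * real (Suc n) ^ e1 * M + C2 * real (Suc n) ^ e2 * M)
          \<le> (C1 + C2) * M * real (Suc n) ^ (e1 + e2)" by simp
    qed
  qed
  with N mult_nonneg_nonneg[OF add_nonneg_nonneg[OF C1(1) C2(1)] M] show ?thesis
    by (intro exI[of _ N] exI[of _ "(C1 + C2) * M"] exI[of _ "e1 + e2"] conjI allI)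
qed

lemma calc_smooth_vectors:
  assumes "w \<in> smooth_vectors" "y \<in> smooth_vectors" "quasi_unitary w" "\<And>k. periodic_Ck k f"
  shows "calc w f y \<in> smooth_vectors"
proof -
  let ?F = "\<lambda>n x. (if n = 0 then 1/2 else 1) *\<^sub>R fourier_coeff f n *\<^sub>R cos_op (\<beta> x w) n (\<beta> x y)"
  have "Ck_on k S (\<lambda>x. \<beta> x (calc w f y))" for k
  proof (rule Ck_on_local)
    fix x0 assume x0: "x0 \<in> S"
    obtain N C e where N: "open N" "x0 \<in> N" "N \<subseteq> S" and C: "0 \<le> C"
      "\<And>n. Ck_bdd k N (\<lambda>x. cos_op (\<beta> x w) n (\<beta> x y)) (C * real (Suc n) ^ (e::nat))"
      using Ck_bdd_cos_op[OF assms(1-3) x0, of k] by (elim exE conjE) (rule that, auto)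
    \<comment> \<open>Decay of order \<open>e\<close> absorbs the growth, and two more orders leave
      a summable series. As \<open>e\<close> depends on \<open>k\<close> and on the point,
      \<open>f\<close> is required to be of class \<open>C^k\<close> for every
      \<open>k\<close>.\<close>
    obtain M where M: "0 \<le> M" "Ck_bdd (e + 2) UNIV f M" using periodic_Ck_bounded[OF assms(4)] by blast
    define K where "K = 2 ^ Suc (e + 2) * M * C"
    have "Ck_on k N (\<lambda>x. \<Sum>n. ?F n x)"
    proof (rule Ck_on_series[OF N(1)])
      \<comment> \<open>The factor 8 is slack that makes \<open>summable_calc_const\<close>
        applicable.\<close>
      show "summable (\<lambda>n. K * (8 / real (Suc n) ^ 2))" by (intro summable_mult summable_calc_const)
      show "0 \<le> K * (8 / real (Suc n) ^ 2)" for n using M(1) C(1) by (simp add: K_def)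
      fix n :: nat
      let ?c = "if n = 0 then 1/2 else 1 :: real"
      have "Ck_bdd k N (?F n) (\<bar>?c\<bar> * (\<bar>fourier_coeff f n\<bar> * (C * real (Suc n) ^ e)))"
        by (intro Ck_bdd_scaleR N(1) C(2))
      then show "Ck_bdd k N (?F n) (K * (8 / real (Suc n) ^ 2))"
      proof (rule Ck_bdd_mono)
        have "\<bar>?c\<bar> * (\<bar>fourier_coeff f n\<bar> * (C * real (Suc n) ^ e)) \<le> 1 * (\<bar>fourier_coeff f n\<bar> * (C * real (Suc n) ^ e))"
          using C(1) by (intro mult_right_mono) auto
        also have "\<dots> \<le> 1 * (2 ^ Suc (e + 2) * M / real (Suc n) ^ (e + 2) * (C * real (Suc n) ^ e))"
          using C(1) by (intro mult_left_mono mult_right_mono fourier_coeff_decay[OF assms(4) M(2)]) auto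
        also have "\<dots> = K * (1 / real (Suc n) ^ 2)"
          by (simp add: K_def power_add power2_eq_square field_simps del: of_nat_Suc)
        also have "\<dots> \<le> K * (8 / real (Suc n) ^ 2)"
          using M(1) C(1) by (intro mult_left_mono divide_right_mono) (auto simp: K_def)
        finally show "\<bar>?c\<bar> * (\<bar>fourier_coeff f n\<bar> * (C * real (Suc n) ^ e)) \<le> K * (8 / real (Suc n) ^ 2)" .
      qed
    qed
    then have "Ck_on k N (\<lambda>x. \<beta> x (calc w f y))"
      by (rule Ck_on_cong[OF N(1), rotated]) (use N(3) assms(3,4) aut_calc in \<open>auto simp: subset_iff\<close>)
    then show "\<exists>N. open N \<and> x0 \<in> N \<and> Ck_on k N (\<lambda>x. \<beta> x (calc w f y))" using N by blast
  qed
  then show ?thesis by (simp add: smooth_vectors_def smooth_on_def)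
qed

end

section \<open>From single charts to the Lie group\<close>

lemma (in smooth_manifold) continuous_on_chart_inverse:
  assumes "(U, \<phi>) \<in> \<A>" "continuous_map T euclidean f"
  shows "continuous_on (\<phi> ` U) (f \<circ> inv_into U \<phi>)"
proof -
  have c: "openin T U" "homeomorphic_map (subtopology T U) (top_of_set (\<phi> ` U)) \<phi>"
    using charts[OF assms(1)] by (auto simp: chart_on_def)
  have U: "topspace (subtopology T U) = U" using openin_subset[OF c(1)] by auto
  obtain g where g: "homeomorphic_maps (subtopology T U) (top_of_set (\<phi> ` U)) \<phi> g"
    using c(2) homeomorphic_map_maps by blast
  then have g': "continuous_map (top_of_set (\<phi> ` U)) (subtopology T U) g" "\<And>u. u \<in> U \<Longrightarrow> g (\<phi> u) = u"
    using U by (auto simp: homeomorphic_maps_def)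
  have "inj_on \<phi> U" using g'(2) by (rule inj_on_inverseI)
  have "continuous_map (top_of_set (\<phi> ` U)) T g"
    using g'(1) by (simp add: continuous_map_in_subtopology)
  from continuous_map_compose[OF this assms(2)] have "continuous_on (\<phi> ` U) (f \<circ> g)" by simp
  then show ?thesis
    by (rule continuous_on_eq) (use g'(2) inv_into_f_f[OF \<open>inj_on \<phi> U\<close>] in auto)
qed

lemma star_subalgebra_INT:
  "(\<And>i. i \<in> I \<Longrightarrow> star_subalgebra (V i)) \<Longrightarrow> star_subalgebra (\<Inter>i\<in>I. V i)"
  by (simp add: star_subalgebra_def)

theorem theorem3p13:
  fixes G :: "('g, 'm) monoid_scheme" and T :: "'g topology"
    and \<A> :: "('g set \<times> ('g \<Rightarrow> 'e::real_normed_vector)) set"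
    and \<alpha> :: "'g \<Rightarrow> 'a::cstar_algebra \<Rightarrow> 'a"
  assumes "lie_group G T \<A>"
    and "strongly_continuous_star_rep G T \<alpha>"
  shows "star_subalgebra (smooth_elements \<A> \<alpha>)
    \<and> cstar_norm_on (smooth_elements \<A> \<alpha>) norm
    \<and> (\<forall>p. cstar_norm_on (smooth_elements \<A> \<alpha>) p
          \<longrightarrow> (\<forall>a\<in>smooth_elements \<A> \<alpha>. p a = norm a))"
proof -
  interpret lie_group G T \<A> by (rule assms(1))
  define \<beta> where "\<beta> U \<phi> x = \<alpha> (inv_into U \<phi> x)" for U :: "'g set" and \<phi> :: "'g \<Rightarrow> 'e" and x
  have action: "local_star_action (\<phi> ` U) (\<beta> U \<phi>)" if A: "(U, \<phi>) \<in> \<A>" for U \<phi>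
  proof
    show "open (\<phi> ` U)" using charts[OF A] by (simp add: chart_on_def)
    have "U \<subseteq> carrier G" using charts[OF A] openin_subset topspace_carrier by (auto simp: chart_on_def)
    then show "star_automorphism (\<beta> U \<phi> x)" if "x \<in> \<phi> ` U" for x
      using assms(2) inv_into_into[OF that] by (auto simp: \<beta>_def strongly_continuous_star_rep_def)
    show "continuous_on (\<phi> ` U) (\<lambda>x. \<beta> U \<phi> x a)" for a
      using continuous_on_chart_inverse[OF A, of "\<lambda>g. \<alpha> g a"] assms(2)
      by (simp add: strongly_continuous_star_rep_def \<beta>_def comp_def)
  qed (rule finite_dim)
  define V where "V i = local_star_action.smooth_vectors (snd i ` fst i) (\<beta> (fst i) (snd i))" for i
  have action': "local_star_action (snd i ` fst i) (\<beta> (fst i) (snd i))" if "i \<in> \<A>" for i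
    using action[of "fst i" "snd i"] that by simp
  define B where "B = smooth_elements \<A> \<alpha>"
  \<comment> \<open>\<open>smooth_map\<close> tests every chart of the atlas separately, so
    \<open>B\<close> is an intersection and each closure property reduces to one chart.\<close>
  have B: "B = (\<Inter>i\<in>\<A>. V i)"
    by (auto simp: B_def V_def local_star_action.smooth_vectors_def[OF action'] smooth_elements_def
        smooth_map_def \<beta>_def comp_def case_prod_beta)
  have sub: "star_subalgebra B"
    unfolding B V_def
    by (rule star_subalgebra_INT) (rule local_star_action.star_subalgebra_smooth_vectors[OF action'])
  moreover have "p a = norm a" if p: "cstar_norm_on B p" and "a \<in> B" for p a
  proof -
    interpret cstar_normed_subalgebra B p by unfold_locales (rule sub p)+
    show ?thesis
    proof (rule p_eq_norm)
      show "d \<in> B" if "b \<in> B" "d = b + b * d" "d = b + d * b" for b d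
        unfolding B
      proof
        fix i assume i: "i \<in> \<A>"
        show "d \<in> V i" unfolding V_def
          by (rule local_star_action.quasi_inverse_smooth_vectors[OF action'[OF i] _ that(2,3)])
            (use that(1) i in \<open>simp add: B V_def\<close>)
      qed
      show "calc w f y \<in> B" if "w \<in> B" "quasi_unitary w" "\<And>k. periodic_Ck k f" "y \<in> B" for w f y
        unfolding B
      proof
        fix i assume i: "i \<in> \<A>"
        show "calc w f y \<in> V i" unfolding V_def
          by (rule local_star_action.calc_smooth_vectors[OF action'[OF i] _ _ that(2,3)])
            (use that(1,4) i in \<open>simp_all add: B V_def\<close>)
      qed
    qed (rule that(2))
  qed
  ultimately show ?thesis unfolding B_def[symmetric] using cstar_norm_on_norm by blast
qed

end
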